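(* In any nominal transition system with a distinguished action $\tau$, for every extended weak formula $E$ there is a weak formula $A$ such that for every state $P$: $P\models E$ iff $P\models A$.
   Context: Nominal sets over a countably infinite (possibly sorted) set of names $\mathcal N$: permutations fix all but finitely many names; every element has finite support $\operatorname{supp}$; $a\# X$ means $a\notin\operatorname{supp}(X)$; $[\mathcal P_{\mathrm{fin}}(\mathcal N)]S$ is $\mathcal P_{\mathrm{fin}}(\mathcal N)\times S$ modulo $(N,X)=_\alpha(N',X')$ iff some $\pi$ with $\pi\cdot(N,X)=(N',X')$ fixes every name of $\operatorname{supp}(X)\setminus N$; classes $\langle N\rangle X$. A nominal transition system: nominal sets STATES, PRED, ACT; equivariant $\vdash\subseteq\mathrm{STATES}\times\mathrm{PRED}$; equivariant $\operatorname{bn}$, $\operatorname{bn}(\alpha)$ a finite subset of $\operatorname{supp}(\alpha)$; equivariant $\rightarrow\ \subseteq\mathrm{STATES}\times[\mathcal P_{\mathrm{fin}}(\mathcal N)](\mathrm{ACT}\times\mathrm{STATES})$ with $(P,\langle N\rangle(\alpha,Q))\in\rightarrow$ only if $N=\operatorname{bn}(\alpha)$; $P\xrightarrow{\alpha}P'$ means $(P,\langle\operatorname{bn}(\alpha)\rangle(\alpha,P'))\in\rightarrow$. $\tau\in\mathrm{ACT}$ is a special action with empty support. Formulas: fix an infinite cardinal $\kappa>\aleph_0$ with $\kappa>|\mathrm{STATES}|$; formulas are $\bigwedge_{i\in I}A_i$ (with $\{A_i\mid i\in I\}$ of cardinality $<\kappa$ and finitely supported), $\neg A$, $\varphi\in\mathrm{PRED}$,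 $\langle\alpha\rangle A$ with $\operatorname{bn}(\alpha)$ bound in $\alpha$ and $A$. $P\models\bigwedge A_i$ iff all $P\models A_i$; $P\models\neg A$ iff not $P\models A$; $P\models\varphi$ iff $P\vdash\varphi$; $P\models\langle\alpha\rangle A$ iff for a representative with $\operatorname{bn}(\alpha)\# P$ some $P'$ has $P\xrightarrow{\alpha}P'$ and $P'\models A$. $\bigvee_{i\in I}A_i=\neg\bigwedge_{i\in I}\neg A_i$ (same conditions on the index set), $A\wedge B$ binary conjunction, $\top$ the empty conjunction. $\langle\tau\rangle^0A=A$, $\langle\tau\rangle^{i+1}A=\langle\tau\rangle\langle\tau\rangle^iA$; $\langle\langle\tau\rangle\rangle A=\bigvee_{i\in\omega}\langle\tau\rangle^iA$ and, for $\alpha\neq\tau$, $\langle\langle\alpha\rangle\rangle A=\langle\langle\tau\rangle\rangle\langle\alpha\rangle\langle\langle\tau\rangle\rangle A$. Weak formulas $A$ are generated by: $\bigwedge_{i\in I}A_i$, $\neg A$, $\langle\langle\alpha\rangle\rangle A$, and $\langle\langle\tau\rangle\rangle(A\wedge\varphi)$ with $\varphi\in\mathrm{PRED}$. Extended weak formulas $E$ and preformulas $B$ are generated simultaneously by $E::=\bigwedge_{i\in I}E_i\mid\neg E\mid\langle\langle\alpha\rangle\rangle E\mid\langle\langle\tau\rangle\rangle B$ and $B::=E\wedge B\mid\varphi\mid\bigvee_{i\in I}B_i$ (index sets always subject to the cardinality $<\kappa$ and finite support conditions); all of these are formulas of the logic above and are interpreted by $\models$. *)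

theory Defs
  imports "HOL-Combinatorics.Perm" "HOL-Library.Countable_Set"
begin

unbundle cardinal_syntax

section \<open>Nominal sets\<close>

text \<open>
  Names form a countably infinite type \<open>'n\<close>, each with a sort, every inhabited sort being infinite
  (the unsorted case is a constant \<open>sort_of\<close>). A nominal set is a carrier together with an action
  of the sort-preserving finite permutations; the action is arbitrary outside the carrier.
\<close>

locale names =
  fixes sort_of :: "'n \<Rightarrow> 'srt"
  assumes countable_names: "countable (UNIV :: 'n set)"
    and infinite_sorts: "infinite {b. sort_of b = sort_of a}"
begin

definition perms :: "'n perm set" where
  "perms = {\<pi>. \<forall>a. sort_of (Perm.apply \<pi> a) = sort_of a}"

definition fixes_names :: "'n perm \<Rightarrow> 'n set \<Rightarrow> bool" where
  "fixes_names \<pi> S \<longleftrightarrow> (\<forall>a\<in>S. Perm.apply \<pi> a = a)"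

definition supports :: "('n perm \<Rightarrow> 'x \<Rightarrow> 'x) \<Rightarrow> 'n set \<Rightarrow> 'x \<Rightarrow> bool" where
  "supports act S x \<longleftrightarrow> (\<forall>\<pi>\<in>perms. fixes_names \<pi> S \<longrightarrow> act \<pi> x = x)"

definition fin_supp :: "('n perm \<Rightarrow> 'x \<Rightarrow> 'x) \<Rightarrow> 'x \<Rightarrow> bool" where
  "fin_supp act x \<longleftrightarrow> (\<exists>S. finite S \<and> supports act S x)"

definition supp :: "('n perm \<Rightarrow> 'x \<Rightarrow> 'x) \<Rightarrow> 'x \<Rightarrow> 'n set" where
  "supp act x = \<Inter> {S. finite S \<and> supports act S x}"

definition nominal_set :: "'x set \<Rightarrow> ('n perm \<Rightarrow> 'x \<Rightarrow> 'x) \<Rightarrow> bool" where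
  "nominal_set X act \<longleftrightarrow>
     (\<forall>x\<in>X. act 1 x = x) \<and>
     (\<forall>\<pi>\<in>perms. \<forall>\<rho>\<in>perms. \<forall>x\<in>X. act (\<pi> * \<rho>) x = act \<pi> (act \<rho> x)) \<and>
     (\<forall>\<pi>\<in>perms. \<forall>x\<in>X. act \<pi> x \<in> X) \<and>
     (\<forall>x\<in>X. fin_supp act x)"

definition act_pair ::
  "('n perm \<Rightarrow> 'x \<Rightarrow> 'x) \<Rightarrow> ('n perm \<Rightarrow> 'y \<Rightarrow> 'y) \<Rightarrow> 'n perm \<Rightarrow> 'x \<times> 'y \<Rightarrow> 'x \<times> 'y" where
  "act_pair act act' \<pi> = map_prod (act \<pi>) (act' \<pi>)"

definition act_set :: "('n perm \<Rightarrow> 'x \<Rightarrow> 'x) \<Rightarrow> 'n perm \<Rightarrow> 'x set \<Rightarrow> 'x set" where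
  "act_set act \<pi> X = act \<pi> ` X"

definition act_npair :: "('n perm \<Rightarrow> 'x \<Rightarrow> 'x) \<Rightarrow> 'n perm \<Rightarrow> 'n set \<times> 'x \<Rightarrow> 'n set \<times> 'x" where
  "act_npair act = act_pair (act_set Perm.apply) act"

definition alpha_rel :: "('n perm \<Rightarrow> 'x \<Rightarrow> 'x) \<Rightarrow> (('n set \<times> 'x) \<times> ('n set \<times> 'x)) set" where
  "alpha_rel act = {((N, x), (N', x')).
     \<exists>\<pi>\<in>perms. act_npair act \<pi> (N, x) = (N', x') \<and> fixes_names \<pi> (supp act x - N)}"

definition abstr :: "('n perm \<Rightarrow> 'x \<Rightarrow> 'x) \<Rightarrow> 'n set \<Rightarrow> 'x \<Rightarrow> ('n set \<times> 'x) set" where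
  "abstr act N x = alpha_rel act `` {(N, x)}"

definition abstr_set :: "'x set \<Rightarrow> ('n perm \<Rightarrow> 'x \<Rightarrow> 'x) \<Rightarrow> ('n set \<times> 'x) set set" where
  "abstr_set X act = ({N. finite N} \<times> X) // alpha_rel act"

end


section \<open>Nominal transition systems\<close>

record ('n, 'srt, 's, 'p, 'a) nts =
  sort_of :: "'n \<Rightarrow> 'srt"
  STATES :: "'s set"
  act_S :: "'n perm \<Rightarrow> 's \<Rightarrow> 's"
  PRED :: "'p set"
  act_P :: "'n perm \<Rightarrow> 'p \<Rightarrow> 'p"
  ACT :: "'a set"
  act_A :: "'n perm \<Rightarrow> 'a \<Rightarrow> 'a"
  entails :: "('s \<times> 'p) set"
  bn :: "'a \<Rightarrow> 'n set"
  transitions :: "('s \<times> ('n set \<times> ('a \<times> 's)) set) set"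
  tau :: 'a

locale nominal_transition_system = names "sort_of T"
  for T :: "('n, 'srt, 's, 'p, 'a) nts" +
  assumes nominal_STATES: "nominal_set (STATES T) (act_S T)"
    and nominal_PRED: "nominal_set (PRED T) (act_P T)"
    and nominal_ACT: "nominal_set (ACT T) (act_A T)"
    and entails_carrier: "entails T \<subseteq> STATES T \<times> PRED T"
    and entails_eqvt:
      "\<lbrakk>\<pi> \<in> perms; (P, \<phi>) \<in> entails T\<rbrakk> \<Longrightarrow> (act_S T \<pi> P, act_P T \<pi> \<phi>) \<in> entails T"
    and bn_finite: "\<alpha> \<in> ACT T \<Longrightarrow> finite (bn T \<alpha>)"
    and bn_supp: "\<alpha> \<in> ACT T \<Longrightarrow> bn T \<alpha> \<subseteq> supp (act_A T) \<alpha>"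
    and bn_eqvt:
      "\<lbrakk>\<pi> \<in> perms; \<alpha> \<in> ACT T\<rbrakk> \<Longrightarrow> bn T (act_A T \<pi> \<alpha>) = act_set Perm.apply \<pi> (bn T \<alpha>)"
    and trans_carrier:
      "transitions T \<subseteq> STATES T \<times> abstr_set (ACT T \<times> STATES T) (act_pair (act_A T) (act_S T))"
    and trans_eqvt: "\<lbrakk>\<pi> \<in> perms; (P, R) \<in> transitions T\<rbrakk> \<Longrightarrow>
      (act_S T \<pi> P, act_set (act_npair (act_pair (act_A T) (act_S T))) \<pi> R) \<in> transitions T"
    and trans_bn: "\<lbrakk>finite N; \<alpha> \<in> ACT T; Q \<in> STATES T;
      (P, abstr (act_pair (act_A T) (act_S T)) N (\<alpha>, Q)) \<in> transitions T\<rbrakk> \<Longrightarrow> N = bn T \<alpha>"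
    and tau_ACT: "tau T \<in> ACT T"
    and supp_tau: "supp (act_A T) (tau T) = {}"
begin

definition step :: "'s \<Rightarrow> 'a \<Rightarrow> 's \<Rightarrow> bool" where
  "step P \<alpha> P' \<longleftrightarrow> \<alpha> \<in> ACT T \<and> P' \<in> STATES T \<and>
     (P, abstr (act_pair (act_A T) (act_S T)) (bn T \<alpha>) (\<alpha>, P')) \<in> transitions T"

end


section \<open>Formulas\<close>

text \<open>
  Raw syntax trees. The children of a conjunction are the values of a partial function on the
  type \<open>'k\<close> that carries the cardinal \<open>\<kappa>\<close>.
\<close>

datatype ('k, 'a, 'p) raw =
    RConj "'k \<Rightarrow> ('k, 'a, 'p) raw option"
  | RNeg "('k, 'a, 'p) raw"
  | RPred 'p
  | RAct 'a "('k, 'a, 'p) raw"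

text \<open>
  A formula is represented by the set of all raw trees that denote it: these trees differ in the
  choice of bound names and in the indexing of the conjuncts. Thus \<open>Conj\<close> is a constructor on sets
  of formulas, and \<open>Dia \<alpha> A\<close> is determined by the abstraction \<open>abstr _ (bn \<alpha>) (\<alpha>, A)\<close>, where the
  support of \<open>A\<close> is that of the formula (not of a raw tree).
\<close>

type_synonym ('k, 'a, 'p) form = "('k, 'a, 'p) raw set"

locale nts_logic = nominal_transition_system T
  for T :: "('n, 'srt, 's, 'p, 'a) nts" +
  fixes \<kappa> :: "'k rel"
  assumes card_kappa: "Card_order \<kappa>"
    and kappa_uncountable: "natLeq <o \<kappa>"
    and kappa_STATES: "|STATES T| <o \<kappa>"
begin

definition act_F :: "'n perm \<Rightarrow> ('k, 'a, 'p) form \<Rightarrow> ('k, 'a, 'p) form" where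
  "act_F = act_set (\<lambda>\<pi>. map_raw (act_A T \<pi>) (act_P T \<pi>))"

definition Conj :: "('k, 'a, 'p) form set \<Rightarrow> ('k, 'a, 'p) form" where
  "Conj X = {RConj f | f. (\<forall>t\<in>ran f. \<exists>A\<in>X. t \<in> A) \<and> (\<forall>A\<in>X. \<exists>t\<in>ran f. t \<in> A)}"

definition Neg :: "('k, 'a, 'p) form \<Rightarrow> ('k, 'a, 'p) form" where
  "Neg A = RNeg ` A"

definition Pred :: "'p \<Rightarrow> ('k, 'a, 'p) form" where
  "Pred \<phi> = {RPred \<phi>}"

definition Dia :: "'a \<Rightarrow> ('k, 'a, 'p) form \<Rightarrow> ('k, 'a, 'p) form" where
  "Dia \<alpha> A = {RAct \<beta> t | N \<beta> B t.
     (N, (\<beta>, B)) \<in> abstr (act_pair (act_A T) act_F) (bn T \<alpha>) (\<alpha>, A) \<and> t \<in> B}"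

definition small :: "('k, 'a, 'p) form set \<Rightarrow> bool" where
  "small X \<longleftrightarrow> |X| <o \<kappa> \<and> fin_supp (act_set act_F) X"

inductive_set formulas :: "('k, 'a, 'p) form set" where
  "\<lbrakk>\<And>A. A \<in> X \<Longrightarrow> A \<in> formulas; small X\<rbrakk> \<Longrightarrow> Conj X \<in> formulas"
| "A \<in> formulas \<Longrightarrow> Neg A \<in> formulas"
| "\<phi> \<in> PRED T \<Longrightarrow> Pred \<phi> \<in> formulas"
| "\<lbrakk>\<alpha> \<in> ACT T; A \<in> formulas\<rbrakk> \<Longrightarrow> Dia \<alpha> A \<in> formulas"

definition Disj :: "('k, 'a, 'p) form set \<Rightarrow> ('k, 'a, 'p) form" where
  "Disj X = Neg (Conj (Neg ` X))"

definition And :: "('k, 'a, 'p) form \<Rightarrow> ('k, 'a, 'p) form \<Rightarrow> ('k, 'a, 'p) form" where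
  "And A B = Conj {A, B}"

definition WDia_tau :: "('k, 'a, 'p) form \<Rightarrow> ('k, 'a, 'p) form" where
  "WDia_tau A = Disj (range (\<lambda>i :: nat. (Dia (tau T) ^^ i) A))"

definition WDia :: "'a \<Rightarrow> ('k, 'a, 'p) form \<Rightarrow> ('k, 'a, 'p) form" where
  "WDia \<alpha> A = (if \<alpha> = tau T then WDia_tau A else WDia_tau (Dia \<alpha> (WDia_tau A)))"

subsection \<open>Weak and extended weak formulas\<close>

inductive_set weak :: "('k, 'a, 'p) form set" where
  "\<lbrakk>\<And>A. A \<in> X \<Longrightarrow> A \<in> weak; small X\<rbrakk> \<Longrightarrow> Conj X \<in> weak"
| "A \<in> weak \<Longrightarrow> Neg A \<in> weak"
| "\<lbrakk>\<alpha> \<in> ACT T; A \<in> weak\<rbrakk> \<Longrightarrow> WDia \<alpha> A \<in> weak"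
| "\<lbrakk>A \<in> weak; \<phi> \<in> PRED T\<rbrakk> \<Longrightarrow> WDia (tau T) (And A (Pred \<phi>)) \<in> weak"

inductive_set ext_weak :: "('k, 'a, 'p) form set"
  and preformulas :: "('k, 'a, 'p) form set" where
  "\<lbrakk>\<And>E. E \<in> X \<Longrightarrow> E \<in> ext_weak; small X\<rbrakk> \<Longrightarrow> Conj X \<in> ext_weak"
| "E \<in> ext_weak \<Longrightarrow> Neg E \<in> ext_weak"
| "\<lbrakk>\<alpha> \<in> ACT T; E \<in> ext_weak\<rbrakk> \<Longrightarrow> WDia \<alpha> E \<in> ext_weak"
| "B \<in> preformulas \<Longrightarrow> WDia (tau T) B \<in> ext_weak"
| "\<lbrakk>E \<in> ext_weak; B \<in> preformulas\<rbrakk> \<Longrightarrow> And E B \<in> preformulas"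
| "\<phi> \<in> PRED T \<Longrightarrow> Pred \<phi> \<in> preformulas"
| "\<lbrakk>\<And>B. B \<in> X \<Longrightarrow> B \<in> preformulas; small X\<rbrakk> \<Longrightarrow> Disj X \<in> preformulas"

subsection \<open>Satisfaction\<close>

lemma formulas_nonempty: "A \<in> formulas \<Longrightarrow> A \<noteq> {}"
proof (induction rule: formulas.induct)
  case (1 X)
  then have "|X| <o \<kappa>" by (simp add: small_def)
  moreover have "|Field \<kappa>| =o \<kappa>" using card_kappa by (rule card_of_Field_ordIso)
  ultimately have "|X| \<le>o |Field \<kappa>|"
    using ordIso_symmetric ordLess_ordIso_trans ordLess_imp_ordLeq by blast
  then obtain g where g: "inj_on g X" "g ` X \<subseteq> Field \<kappa>"
    by (auto simp flip: card_of_ordLeq)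
  define f where
    "f k = (if k \<in> g ` X then Some (SOME t. t \<in> inv_into X g k) else None)" for k
  have "ran f = (\<lambda>A. SOME t. t \<in> A) ` X"
  proof (intro equalityI subsetI)
    fix t assume "t \<in> ran f"
    then obtain k where "f k = Some t" by (auto simp: ran_def)
    then show "t \<in> (\<lambda>A. SOME t. t \<in> A) ` X"
      using g(1) by (auto simp: f_def split: if_splits)
  next
    fix t assume "t \<in> (\<lambda>A. SOME t. t \<in> A) ` X"
    then obtain A where "A \<in> X" "t = (SOME t. t \<in> A)" by blast
    then have "f (g A) = Some t" using g(1) by (simp add: f_def)
    then show "t \<in> ran f" by (rule ranI)
  qed
  moreover have "(SOME t. t \<in> A) \<in> A" if "A \<in> X" for A
    using 1 that by (simp add: some_in_eq)
  ultimately have "\<forall>t\<in>ran f. \<exists>A\<in>X. t \<in> A" "\<forall>A\<in>X. \<exists>t\<in>ran f. t \<in> A" by auto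
  then have "RConj f \<in> Conj X" unfolding Conj_def mem_Collect_eq by (intro exI conjI) (rule refl)
  then show ?case by blast
next
  case (4 \<alpha> A)
  then obtain t where "t \<in> A" by blast
  then have "map_raw (act_A T 1) (act_P T 1) t \<in> act_F 1 A"
    by (simp add: act_F_def act_set_def)
  moreover have "(act_set Perm.apply 1 (bn T \<alpha>), (act_A T 1 \<alpha>, act_F 1 A))
      \<in> abstr (act_pair (act_A T) act_F) (bn T \<alpha>) (\<alpha>, A)"
    unfolding abstr_def alpha_rel_def
    by (auto simp: act_npair_def act_pair_def perms_def fixes_names_def
        intro!: exI[of _ "1 :: 'n perm"])
  ultimately have "RAct (act_A T 1 \<alpha>) (map_raw (act_A T 1) (act_P T 1) t) \<in> Dia \<alpha> A"
    unfolding Dia_def by blast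
  then show ?case by blast
qed (auto simp: Neg_def Pred_def)

text \<open>
  Termination: a child of a formula has trees of the same shape as the corresponding subtrees,
  since permutations only change the labels.
\<close>

definition shape :: "('k, 'a, 'p) raw \<Rightarrow> ('k, unit, unit) raw" where
  "shape = map_raw (\<lambda>_. ()) (\<lambda>_. ())"

definition child :: "(('k, unit, unit) raw \<times> ('k, unit, unit) raw) set" where
  "child = {(s, t). (\<exists>f. t = RConj f \<and> s \<in> ran f) \<or> t = RNeg s \<or> (\<exists>\<alpha>. t = RAct \<alpha> s)}"

definition form_rel :: "(('s \<times> ('k, 'a, 'p) form) \<times> ('s \<times> ('k, 'a, 'p) form)) set" where
  "form_rel = {((Q, A), (P, C)). C \<noteq> {} \<and> (\<forall>t\<in>C. \<exists>s\<in>A. (shape s, shape t) \<in> child)}"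

lemma wf_child: "wf child"
  unfolding wf_def
proof (intro allI impI)
  fix R and t :: "('k, unit, unit) raw"
  assume "\<forall>x. (\<forall>y. (y, x) \<in> child \<longrightarrow> R y) \<longrightarrow> R x"
  then have step: "(\<And>s. (s, t) \<in> child \<Longrightarrow> R s) \<Longrightarrow> R t" for t by blast
  show "R t"
  proof (induction t)
    case (RConj f)
    then have *: "R s" if "s \<in> ran f" for s
      using that by (fastforce simp: ran_def)
    show ?case by (rule step) (simp add: child_def *)
  qed (rule step, simp add: child_def)+
qed

lemma wf_form_rel: "wf form_rel"
proof -
  have "shape t = u \<Longrightarrow> t \<in> C \<Longrightarrow> (P, C) \<in> Wellfounded.acc form_rel" for t u C P
  proof (induction u arbitrary: t C P rule: wf_induct_rule[OF wf_child])
    case (1 u)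
    show ?case
    proof (rule acc.accI)
      fix y assume "(y, (P, C)) \<in> form_rel"
      then obtain Q A s where "y = (Q, A)" "s \<in> A" "(shape s, u) \<in> child"
        using 1 by (cases y) (force simp: form_rel_def)
      then show "y \<in> Wellfounded.acc form_rel" using 1 by blast
    qed
  qed
  moreover have "(P, {}) \<in> Wellfounded.acc form_rel" for P
    by (rule acc.accI) (auto simp: form_rel_def)
  ultimately have "x \<in> Wellfounded.acc form_rel" for x
    by (cases x) (metis ex_in_conv)
  then show ?thesis by (simp add: wf_iff_acc)
qed

lemma form_rel_Conj: "\<lbrakk>Conj X \<in> formulas; A \<in> X\<rbrakk> \<Longrightarrow> ((Q, A), (P, Conj X)) \<in> form_rel"
proof -
  assume "Conj X \<in> formulas" and A: "A \<in> X"
  moreover have "\<exists>s\<in>A. (shape s, shape t) \<in> child" if t: "t \<in> Conj X" for t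
  proof -
    from t A obtain f s k where "t = RConj f" "f k = Some s" "s \<in> A"
      unfolding Conj_def ran_def by auto
    then show ?thesis
      by (intro bexI[of _ s]) (auto simp: child_def shape_def ran_def intro!: exI[of _ k])
  qed
  ultimately show ?thesis using formulas_nonempty by (auto simp: form_rel_def)
qed

lemma form_rel_Neg: "Neg A \<in> formulas \<Longrightarrow> ((Q, A), (P, Neg A)) \<in> form_rel"
  using formulas_nonempty[of "Neg A"]
  by (auto simp: form_rel_def Neg_def child_def shape_def)

lemma form_rel_Dia: "Dia \<alpha> A \<in> formulas \<Longrightarrow> ((Q, A), (P, Dia \<alpha> A)) \<in> form_rel"
proof -
  assume "Dia \<alpha> A \<in> formulas"
  moreover have "\<exists>s\<in>A. (shape s, shape t) \<in> child" if t: "t \<in> Dia \<alpha> A" for t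
  proof -
    from t obtain \<pi> \<beta> s where "t = RAct \<beta> (map_raw (act_A T \<pi>) (act_P T \<pi>) s)" "s \<in> A"
      unfolding Dia_def abstr_def alpha_rel_def
      by (auto simp: act_npair_def act_pair_def act_F_def act_set_def)
    then show ?thesis
      by (intro bexI[of _ s]) (auto simp: child_def shape_def raw.map_comp comp_def)
  qed
  ultimately show ?thesis using formulas_nonempty by (auto simp: form_rel_def)
qed

text \<open>
  The constructors are injective on formulas, except that \<open>Dia \<alpha> A\<close> determines \<open>(\<alpha>, A)\<close> only up
  to renaming of \<open>bn \<alpha>\<close>. Hence the last disjunct asks for some representative of the formula whose
  bound names are fresh for \<open>P\<close>.
\<close>

context
  notes conj_cong [fundef_cong]
begin

function sat :: "'s \<Rightarrow> ('k, 'a, 'p) form \<Rightarrow> bool" (infix \<open>\<Turnstile>\<close> 50) where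
  "P \<Turnstile> C \<longleftrightarrow> C \<in> formulas \<and>
    ((\<exists>X. X \<subseteq> formulas \<and> C = Conj X \<and> (\<forall>A\<in>X. P \<Turnstile> A)) \<or>
     (\<exists>A. A \<in> formulas \<and> C = Neg A \<and> \<not> P \<Turnstile> A) \<or>
     (\<exists>\<phi>. \<phi> \<in> PRED T \<and> C = Pred \<phi> \<and> (P, \<phi>) \<in> entails T) \<or>
     (\<exists>\<alpha> A. \<alpha> \<in> ACT T \<and> A \<in> formulas \<and> C = Dia \<alpha> A \<and> bn T \<alpha> \<inter> supp (act_S T) P = {} \<and>
       (\<exists>P'. step P \<alpha> P' \<and> P' \<Turnstile> A)))"
  by pat_completeness auto
termination
  apply (relation form_rel)
  subgoal by (rule wf_form_rel)
  subgoal by (metis form_rel_Conj)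
  subgoal by (metis form_rel_Neg)
  subgoal by (metis form_rel_Dia)
  done
declare sat.simps [simp del]

end

end

end

theory Submission
  imports Defs
begin

text \<open>
  A preformula \<open>B\<close> is handled through \<open>\<langle>\<langle>\<tau>\<rangle>\<rangle>(A \<and> B)\<close> for all weak \<open>A\<close>: a conjunct \<open>E\<close> of \<open>B\<close> moves into
  \<open>A\<close>, and \<open>\<langle>\<langle>\<tau>\<rangle>\<rangle>\<close> commutes with disjunctions. The point that needs care is finite support: the
  translations of the members of a finitely supported set must again form a finitely supported set,
  so they cannot be chosen arbitrarily. One therefore proves more, namely that every \<open>E\<close> is
  equivalent to a weak \<open>A\<close> fixed
      by all permutations that fix \<open>E\<close>. Choosing such an \<open>A\<close> for one
  representative of each orbit and transporting it along the orbit gives an equivariant translation.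
  To read off stabilisers one needs that formulas are pairwise disjoint sets of trees, hence
  that the constructors are injective up to renaming of bound names.
\<close>

section \<open>Permutations and supports\<close>

text \<open>The stabiliser condition is stronger than an inclusion of supports: a permutation can
  fix \<open>E\<close> while moving names in its support, and transport along an orbit is well
  defined only if \<open>\<pi>\<close> and \<open>\<rho>\<close> agree on \<open>A\<close> whenever
  they agree on \<open>E\<close>. To carry it through the induction, one must recover from a
  permutation fixing a compound formula what it does to the parts, and each constructor hides
  something. \<open>Conj\<close> and \<open>Disj\<close> return only the set of members, which may
  be permuted. \<open>And\<close> returns an unordered pair, so the conjuncts may change places.
  \<open>Dia\<close> returns its body up to a renaming of bound names, and this renaming must also
  be admissible for the translated body, whose support therefore must not be larger.
  \<open>WDia_tau\<close> is an infinite disjunction; its argument is recovered by well-foundedness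
  of the subformula relation. Cardinalities stay below \<open>\<kappa>\<close> because sets of
  formulas are only ever replaced by images.\<close>

context names
begin

section \<open>The group of sort-preserving permutations\<close>

lemma perms_one [simp]: "1 \<in> perms"
  by (simp add: perms_def)

lemma perms_mult [simp]: "\<pi> \<in> perms \<Longrightarrow> \<rho> \<in> perms \<Longrightarrow> \<pi> * \<rho> \<in> perms"
  by (simp add: perms_def apply_times)

lemma apply_inverse_apply [simp]:
  "Perm.apply (inverse \<pi>) (Perm.apply \<pi> a) = a"
  "Perm.apply \<pi> (Perm.apply (inverse \<pi>) a) = a"
  by (simp_all add: apply_sequence)

lemma perms_inverse [simp]:
  assumes "\<pi> \<in> perms"
  shows "inverse \<pi> \<in> perms"
proof -
  have "sort_of (Perm.apply \<pi> (Perm.apply (inverse \<pi>) a)) = sort_of (Perm.apply (inverse \<pi>) a)" for a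
    using assms unfolding perms_def by blast
  then show ?thesis unfolding perms_def by simp
qed

lemma perms_swap:
  assumes "sort_of a = sort_of b"
  shows "Perm.swap a b \<in> perms"
proof -
  have "sort_of (Perm.apply (Perm.swap a b) c) = sort_of c" for c
    using assms by (cases "c = a"; cases "c = b") auto
  then show ?thesis by (simp add: perms_def)
qed

lemma fixes_names_inverse:
  assumes "fixes_names \<pi> S"
  shows "fixes_names (inverse \<pi>) S"
  unfolding fixes_names_def
proof
  fix a assume "a \<in> S"
  then have "Perm.apply \<pi> a = a" using assms by (simp add: fixes_names_def)
  then show "Perm.apply (inverse \<pi>) a = a" using apply_inverse_apply(1)[of \<pi> a] by simp
qed

lemma fixes_names_mult: "fixes_names \<pi> S \<Longrightarrow> fixes_names \<rho> S \<Longrightarrow> fixes_names (\<pi> * \<rho>) S"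
  by (simp add: fixes_names_def apply_times)

lemma fixes_names_image: "fixes_names \<pi> S \<Longrightarrow> Perm.apply \<pi> ` S = S"
  by (simp add: fixes_names_def)

text \<open>The names of \<open>D\<close> are treated one at a time: each is swapped to a name of
  its own sort, and infinitely many of these remain available. This supplies the fresh names for
  \<open>supports_Int\<close> and \<open>equivalent_Dia\<close>.\<close>

lemma move_off:
  assumes "finite D" "finite K" "finite F" "D \<inter> K = {}"
  obtains \<rho> where "\<rho> \<in> perms" "fixes_names \<rho> K" "Perm.apply \<rho> ` D \<inter> F = {}"
proof -
  have "\<exists>\<rho>\<in>perms. fixes_names \<rho> K \<and> Perm.apply \<rho> ` D \<inter> F = {}"
    using assms(1,4)
  proof (induction D)
    case empty
    then show ?case by (intro bexI[of _ 1]) (auto simp: fixes_names_def)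
  next
    case (insert d D)
    then obtain \<rho> where \<rho>: "\<rho> \<in> perms" "fixes_names \<rho> K" "Perm.apply \<rho> ` D \<inter> F = {}" by auto
    let ?x = "Perm.apply \<rho> d"
    have "infinite ({b. sort_of b = sort_of d} - (F \<union> K \<union> Perm.apply \<rho> ` D))"
      using infinite_sorts assms insert by auto
    then have "{b. sort_of b = sort_of d} - (F \<union> K \<union> Perm.apply \<rho> ` D) \<noteq> {}"
      by (rule infinite_imp_nonempty)
    \<comment> \<open>\<open>y\<close> also avoids the images placed so far, so the new swap does
      not disturb them.\<close>
    then obtain y where y: "sort_of y = sort_of d" "y \<notin> F \<union> K \<union> Perm.apply \<rho> ` D" by blast
    have "?x \<notin> K" using \<rho>(2) insert.prems by (metis IntI apply_inj empty_iff fixes_names_def insertI1)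
    moreover have x: "?x \<notin> Perm.apply \<rho> ` D" using insert.hyps by (auto simp: apply_inj)
    moreover have "Perm.swap ?x y \<in> perms" using \<rho>(1) y by (intro perms_swap) (simp add: perms_def)
    moreover have "fixes_names (Perm.swap ?x y * \<rho>) K"
      using \<rho>(2) y \<open>?x \<notin> K\<close> unfolding fixes_names_def apply_times
      by (metis UnCI apply_swap_same comp_apply)
    moreover have "Perm.apply (Perm.swap ?x y * \<rho>) e \<notin> F" if "e \<in> insert d D" for e
    proof (cases "e = d")
      case False
      then have e: "Perm.apply \<rho> e \<in> Perm.apply \<rho> ` D" using that by simp
      have "Perm.apply \<rho> e \<noteq> ?x" using e x by metis
      moreover have "Perm.apply \<rho> e \<noteq> y" using e y(2) by (metis UnCI)
      moreover have "Perm.apply \<rho> e \<notin> F" using e \<rho>(3) by (metis disjoint_iff)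
      ultimately show ?thesis by (simp add: apply_times)
    qed (use y in \<open>simp add: apply_times\<close>)
    ultimately show ?case using \<rho>(1)
      by (intro bexI[of _ "Perm.swap ?x y * \<rho>"]) auto
  qed
  then show thesis using that by blast
qed

text \<open>A permutation that already agrees with \<open>\<sigma>\<close> on part of
  \<open>D\<close> is corrected at the next \<open>d\<close> by swapping \<open>\<rho> d\<close>
  with \<open>\<sigma> d\<close>. Both names lie outside \<open>K\<close>, and injectivity keeps
  them apart from the values that are already right.\<close>

lemma extend_perm:
  assumes "finite D" "\<sigma> \<in> perms" "D \<inter> K = {}" "Perm.apply \<sigma> ` D \<inter> K = {}"
  obtains \<rho> where "\<rho> \<in> perms" "fixes_names \<rho> K"
      "\<And>d. d \<in> D \<Longrightarrow> Perm.apply \<rho> d = Perm.apply \<sigma> d"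
proof -
  have "\<exists>\<rho>\<in>perms. fixes_names \<rho> K \<and> (\<forall>d\<in>D. Perm.apply \<rho> d = Perm.apply \<sigma> d)"
    using assms(1,3,4)
  proof (induction D)
    case empty
    then show ?case by (intro bexI[of _ 1]) (auto simp: fixes_names_def)
  next
    case (insert d D)
    then obtain \<rho> where \<rho>: "\<rho> \<in> perms" "fixes_names \<rho> K"
        "\<forall>d\<in>D. Perm.apply \<rho> d = Perm.apply \<sigma> d"
      by auto
    let ?x = "Perm.apply \<rho> d" and ?y = "Perm.apply \<sigma> d"
    have "?x \<notin> K" using \<rho>(2) insert.prems by (metis IntI apply_inj empty_iff fixes_names_def insertI1)
    moreover have "?y \<notin> K" using insert.prems by auto
    ultimately have "fixes_names (Perm.swap ?x ?y * \<rho>) K"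
      using \<rho>(2) unfolding fixes_names_def apply_times by (metis apply_swap_same comp_apply)
    moreover have "Perm.swap ?x ?y * \<rho> \<in> perms"
      using \<rho>(1) assms(2) by (intro perms_mult perms_swap) (simp_all add: perms_def)
    moreover have "Perm.apply (Perm.swap ?x ?y * \<rho>) e = Perm.apply \<sigma> e" if "e \<in> insert d D" for e
    proof (cases "e = d")
      case False
      then have "Perm.apply \<rho> e \<noteq> ?x" "Perm.apply \<sigma> e \<noteq> ?y" by (simp_all add: apply_inj)
      then show ?thesis using False that \<rho>(3) by (simp add: apply_times)
    qed (simp add: apply_times)
    ultimately show ?case by blast
  qed
  then show thesis using that by blast
qed

lemma mem_abstr_iff:
  "(N', y) \<in> abstr act N x \<longleftrightarrow>
    (\<exists>\<rho>\<in>perms. fixes_names \<rho> (supp act x - N) \<and> N' = Perm.apply \<rho> ` N \<and> y = act \<rho> x)"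
  unfolding abstr_def alpha_rel_def act_npair_def act_pair_def act_set_def by auto

lemma supports_act:
  assumes one: "\<And>x. x \<in> X \<Longrightarrow> act 1 x = x"
    and mult: "\<And>\<pi> \<rho> x. \<pi> \<in> perms \<Longrightarrow> \<rho> \<in> perms \<Longrightarrow> x \<in> X \<Longrightarrow> act (\<pi> * \<rho>) x = act \<pi> (act \<rho> x)"
    and closed: "\<And>\<pi> x. \<pi> \<in> perms \<Longrightarrow> x \<in> X \<Longrightarrow> act \<pi> x \<in> X"
    and x: "\<pi> \<in> perms" "x \<in> X" "supports act S x"
  shows "supports act (Perm.apply \<pi> ` S) (act \<pi> x)"
  unfolding supports_def
proof (intro ballI impI)
  fix \<rho> assume \<rho>: "\<rho> \<in> perms" "fixes_names \<rho> (Perm.apply \<pi> ` S)"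
  then have "fixes_names (inverse \<pi> * (\<rho> * \<pi>)) S" by (simp add: fixes_names_def apply_times)
  then have *: "act (inverse \<pi> * (\<rho> * \<pi>)) x = x"
    using x \<rho> unfolding supports_def by (metis perms_inverse perms_mult)
  have "act \<pi> (act (inverse \<pi> * (\<rho> * \<pi>)) x) = act (\<pi> * (inverse \<pi> * (\<rho> * \<pi>))) x"
    using x \<rho> by (intro mult[symmetric]) auto
  also have "\<pi> * (inverse \<pi> * (\<rho> * \<pi>)) = \<rho> * \<pi>" by (simp flip: mult.assoc)
  finally show "act \<rho> (act \<pi> x) = act \<pi> x" using * x \<rho> mult by simp
qed

text \<open>This is how sets of trees yield the nominal set \<open>preforms\<close> before anything
  is known about formulas.\<close>

lemma nominal_set_fin_supp:
  assumes "\<And>x. x \<in> X \<Longrightarrow> act 1 x = x"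
    and "\<And>\<pi> \<rho> x. \<pi> \<in> perms \<Longrightarrow> \<rho> \<in> perms \<Longrightarrow> x \<in> X \<Longrightarrow> act (\<pi> * \<rho>) x = act \<pi> (act \<rho> x)"
    and "\<And>\<pi> x. \<pi> \<in> perms \<Longrightarrow> x \<in> X \<Longrightarrow> act \<pi> x \<in> X"
  shows "nominal_set {x \<in> X. fin_supp act x} act"
proof -
  have "fin_supp act (act \<pi> x)" if "\<pi> \<in> perms" "x \<in> X" "fin_supp act x" for \<pi> x
    using that supports_act[OF assms] unfolding fin_supp_def by (metis finite_imageI)
  then show ?thesis using assms unfolding nominal_set_def by auto
qed

section \<open>Support theory of a fixed nominal set\<close>

context
  fixes X :: "'x set" and act :: "'n perm \<Rightarrow> 'x \<Rightarrow> 'x"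
  assumes nominal: "nominal_set X act"
begin

lemma nominal_one: "x \<in> X \<Longrightarrow> act 1 x = x"
  and nominal_mult: "\<pi> \<in> perms \<Longrightarrow> \<rho> \<in> perms \<Longrightarrow> x \<in> X \<Longrightarrow> act (\<pi> * \<rho>) x = act \<pi> (act \<rho> x)"
  and nominal_closed: "\<pi> \<in> perms \<Longrightarrow> x \<in> X \<Longrightarrow> act \<pi> x \<in> X"
  and nominal_fin_supp: "x \<in> X \<Longrightarrow> fin_supp act x"
  using nominal by (auto simp: nominal_set_def)

lemma nominal_inverse:
  assumes "\<pi> \<in> perms" "x \<in> X"
  shows "act (inverse \<pi>) (act \<pi> x) = x" "act \<pi> (act (inverse \<pi>) x) = x"
  using assms nominal_mult[of "inverse \<pi>" \<pi> x] nominal_mult[of \<pi> "inverse \<pi>" x] nominal_one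
  by auto

lemma nominal_act_eq_iff:
  "\<pi> \<in> perms \<Longrightarrow> x \<in> X \<Longrightarrow> y \<in> X \<Longrightarrow> act \<pi> x = act \<pi> y \<longleftrightarrow> x = y"
  by (metis nominal_inverse(1))

lemma nominal_supports_act:
  "\<pi> \<in> perms \<Longrightarrow> x \<in> X \<Longrightarrow> supports act S x \<Longrightarrow> supports act (Perm.apply \<pi> ` S) (act \<pi> x)"
  by (rule supports_act[of X]) (auto simp: nominal_one nominal_mult nominal_closed)

text \<open>Moving \<open>S - S'\<close> to names untouched
    by the given permutation, while fixing \<open>S'\<close>, keeps \<open>x\<close>
  and turns \<open>S\<close> into a supporting set that the permutation fixes.\<close>

lemma supports_Int:
  assumes "x \<in> X" "finite S" "finite S'" "supports act S x" "supports act S' x"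
  shows "supports act (S \<inter> S') x"
  unfolding supports_def
proof (intro ballI impI)
  fix \<pi> assume \<pi>: "\<pi> \<in> perms" "fixes_names \<pi> (S \<inter> S')"
  obtain \<rho> where \<rho>: "\<rho> \<in> perms" "fixes_names \<rho> S'"
      "Perm.apply \<rho> ` (S - S') \<inter> affected \<pi> = {}"
    using move_off[of "S - S'" S' "affected \<pi>"] assms by auto
  have "act \<rho> x = x" using \<rho> assms by (simp add: supports_def)
  then have "supports act (Perm.apply \<rho> ` S) x" using nominal_supports_act[OF \<rho>(1) assms(1,4)] by simp
  moreover have "fixes_names \<pi> (Perm.apply \<rho> ` S)"
    unfolding fixes_names_def
  proof
    fix b assume "b \<in> Perm.apply \<rho> ` S"
    then obtain a where a: "a \<in> S" "b = Perm.apply \<rho> a" by blast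
    show "Perm.apply \<pi> b = b"
    proof (cases "a \<in> S'")
      case True
      then show ?thesis using a \<pi> \<rho> by (simp add: fixes_names_def)
    next
      case False
      then have "b \<notin> affected \<pi>" using a \<rho>(3) by blast
      then show ?thesis by (simp add: in_affected)
    qed
  qed
  ultimately show "act \<pi> x = x" using \<pi> by (simp add: supports_def)
qed

lemma supp_supports:
  assumes x: "x \<in> X"
  shows "finite (supp act x)" "supports act (supp act x) x"
proof -
  let ?F = "{S. finite S \<and> supports act S x}"
  obtain S where S: "S \<in> ?F" using nominal_fin_supp[OF x] by (auto simp: fin_supp_def)
  then show fin: "finite (supp act x)" unfolding supp_def by (auto intro: finite_subset)
  \<comment> \<open>\<open>supp\<close> may intersect infinitely many sets, while
    \<open>supports_Int\<close> handles two. A finite supporting set of least cardinality cannot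
    shrink when intersected with another one, so it is contained in all of them and equals
    \<open>supp\<close>.\<close>
  obtain S0 where S0: "S0 \<in> ?F" "\<And>S. S \<in> ?F \<Longrightarrow> card S0 \<le> card S"
    using ex_has_least_nat[of "\<lambda>S. S \<in> ?F" S card] S by blast
  have "S0 \<subseteq> S" if "S \<in> ?F" for S
  proof -
    have "S0 \<inter> S \<in> ?F" using S0 that x supports_Int by auto
    then have "card S0 \<le> card (S0 \<inter> S)" by (rule S0(2))
    then have "S0 \<inter> S = S0" using S0(1) by (intro card_seteq) auto
    then show ?thesis by blast
  qed
  then have "supp act x = S0" using S0(1) unfolding supp_def by blast
  then show "supports act (supp act x) x" using S0(1) by simp
qed

lemma supp_subset: "finite S \<Longrightarrow> supports act S x \<Longrightarrow> supp act x \<subseteq> S"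
  unfolding supp_def by blast

lemma act_supp_fixed: "x \<in> X \<Longrightarrow> \<pi> \<in> perms \<Longrightarrow> fixes_names \<pi> (supp act x) \<Longrightarrow> act \<pi> x = x"
  using supp_supports(2) by (simp add: supports_def)

lemma supp_act:
  assumes "\<pi> \<in> perms" "x \<in> X"
  shows "supp act (act \<pi> x) = Perm.apply \<pi> ` supp act x"
proof -
  have sub: "supp act (act \<pi> x) \<subseteq> Perm.apply \<pi> ` supp act x" if "\<pi> \<in> perms" "x \<in> X" for \<pi> x
    using that supp_supports[OF that(2)] by (simp add: supp_subset nominal_supports_act)
  have "supp act x \<subseteq> Perm.apply (inverse \<pi>) ` supp act (act \<pi> x)"
    using sub[of "inverse \<pi>" "act \<pi> x"] assms by (simp add: nominal_closed nominal_inverse)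
  then have "Perm.apply \<pi> ` supp act x \<subseteq> Perm.apply \<pi> ` Perm.apply (inverse \<pi>) ` supp act (act \<pi> x)"
    by (rule image_mono)
  then have "Perm.apply \<pi> ` supp act x \<subseteq> supp act (act \<pi> x)" by (simp add: image_image)
  then show ?thesis using sub assms by blast
qed

lemma act_set_closed: "\<pi> \<in> perms \<Longrightarrow> Z \<subseteq> X \<Longrightarrow> act_set act \<pi> Z \<subseteq> X"
  by (auto simp: act_set_def nominal_closed)

lemma act_set_inverse:
  "\<pi> \<in> perms \<Longrightarrow> Z \<subseteq> X \<Longrightarrow> act_set act (inverse \<pi>) (act_set act \<pi> Z) = Z"
  "\<pi> \<in> perms \<Longrightarrow> Z \<subseteq> X \<Longrightarrow> act_set act \<pi> (act_set act (inverse \<pi>) Z) = Z"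
  unfolding act_set_def image_image
  by (rule trans[OF image_cong[OF refl] image_ident]; auto simp: nominal_inverse)+

lemma act_set_mult:
  "\<pi> \<in> perms \<Longrightarrow> \<rho> \<in> perms \<Longrightarrow> Z \<subseteq> X \<Longrightarrow> act_set act (\<pi> * \<rho>) Z = act_set act \<pi> (act_set act \<rho> Z)"
  unfolding act_set_def image_image by (rule image_cong) (auto simp: nominal_mult)

text \<open>The free names \<open>supp act x - N\<close> are the same for the renamed pair, so the
  renamings of one pair become those of the other by composition with \<open>\<pi>\<close> or its
  inverse.\<close>

lemma abstr_act:
  assumes "x \<in> X" "\<pi> \<in> perms" "fixes_names \<pi> (supp act x - N)"
  shows "abstr act (Perm.apply \<pi> ` N) (act \<pi> x) = abstr act N x"
proof -
  have supp: "supp act (act \<pi> x) - Perm.apply \<pi> ` N = supp act x - N"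
    using assms(3) fixes_names_image[of \<pi> "supp act x - N"] assms(1,2)
    by (simp add: supp_act image_set_diff[symmetric] bij_is_inj)
  show ?thesis
  proof (intro set_eqI iffI; clarify)
    fix N' y assume "(N', y) \<in> abstr act (Perm.apply \<pi> ` N) (act \<pi> x)"
    then obtain \<rho> where "\<rho> \<in> perms" "fixes_names \<rho> (supp act x - N)"
        "N' = Perm.apply \<rho> ` Perm.apply \<pi> ` N" "y = act \<rho> (act \<pi> x)"
      unfolding mem_abstr_iff supp by blast
    then show "(N', y) \<in> abstr act N x"
      unfolding mem_abstr_iff using assms
      by (intro bexI[of _ "\<rho> * \<pi>"]) (simp_all add: fixes_names_mult nominal_mult apply_times image_comp)
  next
    fix N' y assume "(N', y) \<in> abstr act N x"
    then obtain \<rho> where "\<rho> \<in> perms" "fixes_names \<rho> (supp act x - N)"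
        "N' = Perm.apply \<rho> ` N" "y = act \<rho> x"
      unfolding mem_abstr_iff by blast
    then show "(N', y) \<in> abstr act (Perm.apply \<pi> ` N) (act \<pi> x)"
      unfolding mem_abstr_iff supp using assms
      by (intro bexI[of _ "\<rho> * inverse \<pi>"])
        (simp_all add: fixes_names_mult fixes_names_inverse nominal_mult nominal_closed nominal_inverse
          apply_times image_image)
  qed
qed

text \<open>Conjugation by \<open>\<pi>\<close> matches the renamings that fix the free names of
  \<open>x\<close> with those that fix the free names of \<open>act \<pi> x\<close>.\<close>

lemma act_abstr:
  assumes "x \<in> X" "\<pi> \<in> perms"
  shows "act_set (act_npair act) \<pi> (abstr act N x) = abstr act (Perm.apply \<pi> ` N) (act \<pi> x)"
proof -
  have supp: "supp act (act \<pi> x) - Perm.apply \<pi> ` N = Perm.apply \<pi> ` (supp act x - N)"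
    using assms by (simp add: supp_act image_set_diff bij_is_inj)
  show ?thesis
  proof (intro set_eqI iffI; clarify)
    fix N' y assume "(N', y) \<in> act_set (act_npair act) \<pi> (abstr act N x)"
    then obtain M z where "(M, z) \<in> abstr act N x" "N' = Perm.apply \<pi> ` M" "y = act \<pi> z"
      unfolding act_set_def act_npair_def act_pair_def by auto
    then obtain \<rho> where \<rho>: "\<rho> \<in> perms" "fixes_names \<rho> (supp act x - N)"
        "N' = Perm.apply \<pi> ` Perm.apply \<rho> ` N" "y = act \<pi> (act \<rho> x)"
      unfolding mem_abstr_iff by blast
    then show "(N', y) \<in> abstr act (Perm.apply \<pi> ` N) (act \<pi> x)"
      unfolding mem_abstr_iff supp using assms
      by (intro bexI[of _ "\<pi> * \<rho> * inverse \<pi>"])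
        (simp_all add: fixes_names_def nominal_mult nominal_closed nominal_inverse apply_times image_image)
  next
    fix N' y assume "(N', y) \<in> abstr act (Perm.apply \<pi> ` N) (act \<pi> x)"
    then obtain \<rho> where \<rho>: "\<rho> \<in> perms" "fixes_names \<rho> (Perm.apply \<pi> ` (supp act x - N))"
        "N' = Perm.apply \<rho> ` Perm.apply \<pi> ` N" "y = act \<rho> (act \<pi> x)"
      unfolding mem_abstr_iff supp by blast
    let ?\<sigma> = "inverse \<pi> * \<rho> * \<pi>"
    have "(Perm.apply ?\<sigma> ` N, act ?\<sigma> x) \<in> abstr act N x"
      unfolding mem_abstr_iff using \<rho> assms
      by (intro bexI[of _ ?\<sigma>]) (simp_all add: fixes_names_def apply_times)
    moreover have "(N', y) = act_npair act \<pi> (Perm.apply ?\<sigma> ` N, act ?\<sigma> x)"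
      using \<rho> assms unfolding act_npair_def act_pair_def act_set_def
      by (simp add: nominal_mult nominal_closed nominal_inverse apply_times image_image)
    ultimately show "(N', y) \<in> act_set (act_npair act) \<pi> (abstr act N x)"
      unfolding act_set_def by blast
  qed
qed

end

section \<open>Products of nominal sets\<close>

lemma act_pair_simp [simp]: "act_pair act act' \<pi> (x, y) = (act \<pi> x, act' \<pi> y)"
  by (simp add: act_pair_def)

lemma supports_mono: "supports act S x \<Longrightarrow> S \<subseteq> S' \<Longrightarrow> supports act S' x"
  by (auto simp: supports_def fixes_names_def)

lemma supports_pair:
  "supports (act_pair act act') S (x, y) \<longleftrightarrow> supports act S x \<and> supports act' S y"
  by (auto simp: supports_def)

lemma nominal_set_pair:
  assumes "nominal_set X act" "nominal_set Y act'"
  shows "nominal_set (X \<times> Y) (act_pair act act')"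
proof -
  have "fin_supp (act_pair act act') (x, y)" if xy: "x \<in> X" "y \<in> Y" for x y
  proof -
    obtain S S' where "finite S" "supports act S x" "finite S'" "supports act' S' y"
      using nominal_fin_supp[OF assms(1) xy(1)] nominal_fin_supp[OF assms(2) xy(2)]
      unfolding fin_supp_def by blast
    then show ?thesis unfolding fin_supp_def supports_pair
      by (intro exI[of _ "S \<union> S'"]) (auto intro: supports_mono)
  qed
  then show ?thesis using assms unfolding nominal_set_def by auto
qed

lemma supp_pair:
  assumes "nominal_set X act" "nominal_set Y act'" "x \<in> X" "y \<in> Y"
  shows "supp (act_pair act act') (x, y) = supp act x \<union> supp act' y"
proof
  note X = supp_supports[OF assms(1,3)] and Y = supp_supports[OF assms(2,4)]
  show "supp (act_pair act act') (x, y) \<subseteq> supp act x \<union> supp act' y"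
    using X Y by (intro supp_subset[OF nominal_set_pair[OF assms(1,2)]])
      (auto simp: supports_pair intro: supports_mono)
  note XY = supp_supports[OF nominal_set_pair[OF assms(1,2)], of "(x, y)"]
  show "supp act x \<union> supp act' y \<subseteq> supp (act_pair act act') (x, y)"
    using XY assms supp_subset[OF assms(1)] supp_subset[OF assms(2)] by (simp add: supports_pair)
qed

text \<open>A choice can be made equivariant once every chosen value is fixed by the stabiliser of its
  argument: choose on one representative of each orbit and transport.\<close>

lemma equivariant_choice:
  assumes X: "nominal_set X act" and Y: "nominal_set Y act'"
    and carrier: "\<And>x y. R x y \<Longrightarrow> x \<in> X \<and> y \<in> Y"
    and eqvt: "\<And>\<pi> x y. \<pi> \<in> perms \<Longrightarrow> R x y \<Longrightarrow> R (act \<pi> x) (act' \<pi> y)"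
  obtains f where
    "\<And>x y. R x y \<Longrightarrow> \<forall>\<pi>\<in>perms. act \<pi> x = x \<longrightarrow> act' \<pi> y = y \<Longrightarrow>
      R x (f x) \<and> (\<forall>\<pi>\<in>perms. f (act \<pi> x) = act' \<pi> (f x))"
proof -
  define good where "good x y \<longleftrightarrow> R x y \<and> (\<forall>\<pi>\<in>perms. act \<pi> x = x \<longrightarrow> act' \<pi> y = y)" for x y
  \<comment> \<open>The stabiliser of \<open>act \<pi> x\<close> is the conjugate by
    \<open>\<pi>\<close> of the stabiliser of \<open>x\<close>.\<close>
  have good_eqvt: "good (act \<pi> x) (act' \<pi> y)" if "good x y" "\<pi> \<in> perms" for \<pi> x y
    unfolding good_def
  proof (intro conjI ballI impI)
    show "R (act \<pi> x) (act' \<pi> y)" using that eqvt by (simp add: good_def)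
    fix \<rho> assume \<rho>: "\<rho> \<in> perms" "act \<rho> (act \<pi> x) = act \<pi> x"
    have xy: "x \<in> X" "y \<in> Y" using that carrier by (auto simp: good_def)
    have "act (inverse \<pi> * (\<rho> * \<pi>)) x = x"
      using that(2) \<rho> xy by (simp add: nominal_mult[OF X] nominal_closed[OF X] nominal_inverse[OF X])
    then have "act' (inverse \<pi> * (\<rho> * \<pi>)) y = y" using that \<rho> by (simp add: good_def)
    then have "act' (inverse \<pi>) (act' \<rho> (act' \<pi> y)) = y"
      using that(2) \<rho> xy by (simp add: nominal_mult[OF Y] nominal_closed[OF Y])
    then show "act' \<rho> (act' \<pi> y) = act' \<pi> y"
      using that(2) \<rho> xy by (metis nominal_closed[OF Y] nominal_inverse(2)[OF Y])
  qed
  define orb where "orb x = {act \<pi> x | \<pi>. \<pi> \<in> perms}" for x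
  \<comment> \<open>The choice depends on the set \<open>orb x\<close> alone, so all points of an
    orbit receive the same representative.\<close>
  define rep where "rep x = (SOME z. z \<in> orb x)" for x
  define h where "h z = (SOME y. good z y)" for z
  define p where "p x = (SOME \<pi>. \<pi> \<in> perms \<and> act \<pi> (rep x) = x)" for x
  define f where "f x = act' (p x) (h (rep x))" for x
  have orb_act: "orb (act \<pi> x) = orb x" if "x \<in> X" "\<pi> \<in> perms" for x \<pi>
  proof (intro set_eqI iffI)
    fix z assume "z \<in> orb (act \<pi> x)"
    then show "z \<in> orb x" using that unfolding orb_def
      by (smt (verit, best) mem_Collect_eq nominal_mult[OF X] perms_mult)
  next
    fix z assume "z \<in> orb x"
    then obtain \<rho> where "\<rho> \<in> perms" "z = act \<rho> x" unfolding orb_def by blast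
    then have "z = act (\<rho> * inverse \<pi>) (act \<pi> x)" "\<rho> * inverse \<pi> \<in> perms"
      using that by (simp_all add: nominal_mult[OF X] nominal_closed[OF X] nominal_inverse[OF X])
    then show "z \<in> orb (act \<pi> x)" unfolding orb_def by blast
  qed
  have good_f: "R x (f x) \<and> (\<forall>\<pi>\<in>perms. f (act \<pi> x) = act' \<pi> (f x))" if "good x y" for x y
  proof -
    have x: "x \<in> X" using that carrier by (auto simp: good_def)
    then have "x \<in> orb x" unfolding orb_def by (auto simp: nominal_one[OF X] intro!: exI[of _ 1])
    then have "rep x \<in> orb x" unfolding rep_def by (rule someI)
    then obtain \<rho> where \<rho>: "\<rho> \<in> perms" "rep x = act \<rho> x" unfolding orb_def by blast
    have rep: "rep x \<in> X" using \<rho> x by (simp add: nominal_closed[OF X])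
    have "good (rep x) (act' \<rho> y)" using \<rho> that good_eqvt by simp
    then have h: "good (rep x) (h (rep x))" unfolding h_def by (rule someI)
    then have hY: "h (rep x) \<in> Y" using carrier by (auto simp: good_def)
    \<comment> \<open>Two permutations that send the representative to the same point differ by an
      element of its stabiliser, which fixes \<open>h (rep x)\<close>. Hence the arbitrary choice
      made by \<open>p\<close> does not affect \<open>f\<close>.\<close>
    have unique: "act' \<sigma> (h (rep x)) = act' \<sigma>' (h (rep x))"
      if "\<sigma> \<in> perms" "\<sigma>' \<in> perms" "act \<sigma> (rep x) = act \<sigma>' (rep x)" for \<sigma> \<sigma>'
    proof -
      have "act (inverse \<sigma>' * \<sigma>) (rep x) = rep x"
        using that rep by (simp add: nominal_mult[OF X] nominal_inverse[OF X])
      then have "act' (inverse \<sigma>' * \<sigma>) (h (rep x)) = h (rep x)"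
        using h that by (simp add: good_def)
      then have "act' (inverse \<sigma>') (act' \<sigma> (h (rep x))) = h (rep x)"
        using that hY by (simp add: nominal_mult[OF Y])
      then show ?thesis
        using that hY by (metis nominal_closed[OF Y] nominal_inverse(2)[OF Y])
    qed
    have "\<exists>\<pi>. \<pi> \<in> perms \<and> act \<pi> (rep x) = x"
      using \<rho> x by (intro exI[of _ "inverse \<rho>"]) (simp add: nominal_inverse[OF X])
    then have p: "p x \<in> perms" "act (p x) (rep x) = x" unfolding p_def by (metis (mono_tags, lifting) someI_ex)+
    have "f (act \<pi> x) = act' \<pi> (f x)" if \<pi>: "\<pi> \<in> perms" for \<pi>
    proof -
      have rep': "rep (act \<pi> x) = rep x" unfolding rep_def using orb_act[OF x \<pi>] by simp
      have "act (\<pi> * p x) (rep x) = act \<pi> x" using \<pi> p rep by (simp add: nominal_mult[OF X])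
      then have "\<exists>\<sigma>. \<sigma> \<in> perms \<and> act \<sigma> (rep (act \<pi> x)) = act \<pi> x"
        using \<pi> p rep' by (intro exI[of _ "\<pi> * p x"]) simp
      then have "p (act \<pi> x) \<in> perms" "act (p (act \<pi> x)) (rep x) = act \<pi> x"
        unfolding p_def rep'[symmetric] by (metis (mono_tags, lifting) someI_ex)+
      then have "f (act \<pi> x) = act' (\<pi> * p x) (h (rep x))"
        unfolding f_def rep' using \<pi> p rep by (intro unique) (simp_all add: nominal_mult[OF X])
      then show ?thesis unfolding f_def using \<pi> p hY by (simp add: nominal_mult[OF Y])
    qed
    moreover have "R x (f x)"
      using good_eqvt[OF h p(1)] unfolding p(2) f_def[symmetric] by (simp add: good_def)
    ultimately show ?thesis by blast
  qed
  show thesis by (rule that[of f]) (use good_f in \<open>auto simp: good_def\<close>)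
qed

end

context nts_logic
begin

section \<open>Formulas as a nominal set\<close>

abbreviation act_R :: "'n perm \<Rightarrow> ('k, 'a, 'p) raw \<Rightarrow> ('k, 'a, 'p) raw" where
  "act_R \<pi> \<equiv> map_raw (act_A T \<pi>) (act_P T \<pi>)"

abbreviation act_AF :: "'n perm \<Rightarrow> 'a \<times> ('k, 'a, 'p) form \<Rightarrow> 'a \<times> ('k, 'a, 'p) form" where
  "act_AF \<equiv> act_pair (act_A T) act_F"

text \<open>Actions are unconstrained outside the carriers, so the action laws can be expected only
  for trees whose labels all lie in the carriers.\<close>

definition trees :: "('k, 'a, 'p) raw set" where
  "trees = {t. set1_raw t \<subseteq> ACT T \<and> set2_raw t \<subseteq> PRED T}"

lemma act_R_one: "t \<in> trees \<Longrightarrow> act_R 1 t = t"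
  by (rule trans[OF raw.map_cong[OF refl] raw.map_ident])
    (auto simp: trees_def nominal_one[OF nominal_ACT] nominal_one[OF nominal_PRED])

lemma act_R_mult: "\<pi> \<in> perms \<Longrightarrow> \<rho> \<in> perms \<Longrightarrow> t \<in> trees \<Longrightarrow> act_R (\<pi> * \<rho>) t = act_R \<pi> (act_R \<rho> t)"
  unfolding raw.map_comp
  by (rule raw.map_cong[OF refl])
    (auto simp: trees_def nominal_mult[OF nominal_ACT] nominal_mult[OF nominal_PRED])

lemma act_R_closed: "\<pi> \<in> perms \<Longrightarrow> t \<in> trees \<Longrightarrow> act_R \<pi> t \<in> trees"
  by (auto simp: trees_def raw.set_map intro!: nominal_closed[OF nominal_ACT] nominal_closed[OF nominal_PRED])

lemma act_R_inverse: "\<pi> \<in> perms \<Longrightarrow> t \<in> trees \<Longrightarrow> act_R \<pi> (act_R (inverse \<pi>) t) = t"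
  using act_R_mult[of \<pi> "inverse \<pi>" t] act_R_one by simp

text \<open>A provisional nominal set around the formulas. The supports that occur in
  \<open>Dia\<close> have to behave well already inside the induction which shows that formulas form
  a nominal set.\<close>

definition preforms :: "('k, 'a, 'p) form set" where
  "preforms = {A \<in> Pow trees. fin_supp act_F A}"

lemma nominal_preforms: "nominal_set preforms act_F"
  unfolding preforms_def
proof (rule nominal_set_fin_supp)
  show "act_F 1 A = A" if "A \<in> Pow trees" for A
    unfolding act_F_def act_set_def using that
    by (intro trans[OF image_cong[OF refl] image_ident]) (auto simp: act_R_one)
  show "act_F (\<pi> * \<rho>) A = act_F \<pi> (act_F \<rho> A)"
    if "\<pi> \<in> perms" "\<rho> \<in> perms" "A \<in> Pow trees" for \<pi> \<rho> A
    unfolding act_F_def act_set_def image_image using that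
    by (intro image_cong refl) (auto simp: act_R_mult)
  show "act_F \<pi> A \<in> Pow trees" if "\<pi> \<in> perms" "A \<in> Pow trees" for \<pi> A
    using that by (auto simp: act_F_def act_set_def act_R_closed)
qed

lemma nominal_ACT_preforms: "nominal_set (ACT T \<times> preforms) act_AF"
  by (rule nominal_set_pair[OF nominal_ACT nominal_preforms])

section \<open>Equivariance of the constructors\<close>

lemma act_F_Neg: "act_F \<pi> (Neg A) = Neg (act_F \<pi> A)"
  by (auto simp: act_F_def act_set_def Neg_def image_image)

lemma act_F_Pred: "act_F \<pi> (Pred \<phi>) = Pred (act_P T \<pi> \<phi>)"
  by (auto simp: act_F_def act_set_def Pred_def)

lemma act_F_mem: "t \<in> A \<Longrightarrow> act_R \<pi> t \<in> act_F \<pi> A"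
  by (simp add: act_F_def act_set_def)

lemma RConj_mem_Conj_iff:
  "RConj f \<in> Conj X \<longleftrightarrow> (\<forall>t\<in>ran f. \<exists>A\<in>X. t \<in> A) \<and> (\<forall>A\<in>X. \<exists>t\<in>ran f. t \<in> A)"
  by (simp add: Conj_def)

lemma Conj_trees: "X \<subseteq> Pow trees \<Longrightarrow> Conj X \<subseteq> trees"
proof
  fix u assume X: "X \<subseteq> Pow trees" and "u \<in> Conj X"
  then obtain f where u: "u = RConj f" "\<And>t. t \<in> ran f \<Longrightarrow> \<exists>A\<in>X. t \<in> A"
      by (auto simp: Conj_def)
  have f: "t \<in> trees" if "f k = Some t" for k t
  proof -
    have "t \<in> ran f" using that by (rule ranI)
    then show ?thesis using u(2)[of t] X by blast
  qed
  have "set1_raw t \<subseteq> ACT T" "set2_raw t \<subseteq> PRED T" if "t \<in> set_option (f k)" for k t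
    using f[of k t] that by (simp_all add: trees_def elem_set)
  then show "u \<in> trees" unfolding u trees_def mem_Collect_eq raw.set
    by (intro conjI UN_least) (simp_all add: image_iff, (metis)+)
qed

lemma act_F_Conj:
  assumes "\<pi> \<in> perms" "X \<subseteq> preforms"
  shows "act_F \<pi> (Conj X) = Conj (act_set act_F \<pi> X)"
proof
  \<comment> \<open>Stated for every permutation and every set without hypotheses, so that the
    reverse inclusion follows by applying it to \<open>inverse \<pi>\<close>.\<close>
  have sub: "act_F \<pi> (Conj X) \<subseteq> Conj (act_set act_F \<pi> X)" for \<pi> X
  proof
    fix u assume "u \<in> act_F \<pi> (Conj X)"
    then obtain f where f: "u = act_R \<pi> (RConj f)"
        "\<forall>t\<in>ran f. \<exists>A\<in>X. t \<in> A" "\<forall>A\<in>X. \<exists>t\<in>ran f. t \<in> A"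
      unfolding act_F_def act_set_def Conj_def by blast
    have ran: "ran (map_option (act_R \<pi>) \<circ> f) = act_R \<pi> ` ran f" by (auto simp: ran_def)
    have "u = RConj (map_option (act_R \<pi>) \<circ> f)" using f(1) by simp
    moreover have "\<forall>t\<in>act_R \<pi> ` ran f. \<exists>A\<in>act_set act_F \<pi> X. t \<in> A"
    proof
      fix t assume "t \<in> act_R \<pi> ` ran f"
      then obtain s A where "s \<in> A" "A \<in> X" "t = act_R \<pi> s" using f(2) by blast
      then show "\<exists>A\<in>act_set act_F \<pi> X. t \<in> A"
        by (intro bexI[of _ "act_F \<pi> A"]) (auto simp: act_set_def intro: act_F_mem)
    qed
    moreover have "\<forall>A\<in>act_set act_F \<pi> X. \<exists>t\<in>act_R \<pi> ` ran f. t \<in> A"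
    proof
      fix B assume "B \<in> act_set act_F \<pi> X"
      then obtain A s where "A \<in> X" "B = act_F \<pi> A" "s \<in> ran f" "s \<in> A"
        using f(3) unfolding act_set_def by blast
      then show "\<exists>t\<in>act_R \<pi> ` ran f. t \<in> B"
        by (intro bexI[of _ "act_R \<pi> s"]) (auto intro: act_F_mem)
    qed
    ultimately show "u \<in> Conj (act_set act_F \<pi> X)" by (simp only: RConj_mem_Conj_iff ran)
  qed
  show "act_F \<pi> (Conj X) \<subseteq> Conj (act_set act_F \<pi> X)" by (rule sub)
  show "Conj (act_set act_F \<pi> X) \<subseteq> act_F \<pi> (Conj X)"
  proof
    fix u assume u: "u \<in> Conj (act_set act_F \<pi> X)"
    have "act_set act_F \<pi> X \<subseteq> preforms" by (rule act_set_closed[OF nominal_preforms assms])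
    then have "u \<in> trees" using Conj_trees[of "act_set act_F \<pi> X"] u by (auto simp: preforms_def)
    then have *: "u = act_R \<pi> (act_R (inverse \<pi>) u)" using assms act_R_inverse by simp
    have "act_R (inverse \<pi>) u \<in> act_F (inverse \<pi>) (Conj (act_set act_F \<pi> X))"
      using u by (auto simp: act_F_def act_set_def)
    then have "act_R (inverse \<pi>) u \<in> Conj X"
      using sub[of "inverse \<pi>" "act_set act_F \<pi> X"] act_set_inverse(1)[OF nominal_preforms assms] by auto
    then show "u \<in> act_F \<pi> (Conj X)" using * unfolding act_F_def act_set_def by blast
  qed
qed

lemma mem_Dia_iff:
  "u \<in> Dia \<alpha> A \<longleftrightarrow> (\<exists>\<pi>\<in>perms. fixes_names \<pi> (supp act_AF (\<alpha>, A) - bn T \<alpha>) \<and>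
     u \<in> RAct (act_A T \<pi> \<alpha>) ` act_F \<pi> A)"
proof
  assume "u \<in> Dia \<alpha> A"
  then show "\<exists>\<pi>\<in>perms. fixes_names \<pi> (supp act_AF (\<alpha>, A) - bn T \<alpha>) \<and>
     u \<in> RAct (act_A T \<pi> \<alpha>) ` act_F \<pi> A"
    unfolding Dia_def mem_abstr_iff by auto
next
  assume "\<exists>\<pi>\<in>perms. fixes_names \<pi> (supp act_AF (\<alpha>, A) - bn T \<alpha>) \<and>
     u \<in> RAct (act_A T \<pi> \<alpha>) ` act_F \<pi> A"
  then obtain \<pi> where "\<pi> \<in> perms" "fixes_names \<pi> (supp act_AF (\<alpha>, A) - bn T \<alpha>)"
      "u \<in> RAct (act_A T \<pi> \<alpha>) ` act_F \<pi> A" by blast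
  moreover from this have "(Perm.apply \<pi> ` bn T \<alpha>, (act_A T \<pi> \<alpha>, act_F \<pi> A)) \<in> abstr act_AF (bn T \<alpha>) (\<alpha>, A)"
    unfolding mem_abstr_iff by (intro bexI[of _ \<pi>]) simp_all
  ultimately show "u \<in> Dia \<alpha> A" unfolding Dia_def by blast
qed

lemma Dia_alpha:
  assumes "\<alpha> \<in> ACT T" "A \<in> preforms" "\<pi> \<in> perms"
      "fixes_names \<pi> (supp act_AF (\<alpha>, A) - bn T \<alpha>)"
  shows "Dia (act_A T \<pi> \<alpha>) (act_F \<pi> A) = Dia \<alpha> A"
  using abstr_act[OF nominal_ACT_preforms _ assms(3,4)] assms bn_eqvt[OF assms(3,1)]
  by (simp add: Dia_def act_set_def)

text \<open>\<open>Dia \<alpha> A\<close> is a union over the abstraction class of its label and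
  body, and \<open>act_abstr\<close> tells how \<open>\<pi>\<close> moves that class.\<close>

lemma act_F_Dia:
  assumes "\<alpha> \<in> ACT T" "A \<in> preforms" "\<pi> \<in> perms"
  shows "act_F \<pi> (Dia \<alpha> A) = Dia (act_A T \<pi> \<alpha>) (act_F \<pi> A)"
proof -
  have Dia_alt: "Dia \<alpha> A = (\<Union>(N, \<beta>, B) \<in> abstr act_AF (bn T \<alpha>) (\<alpha>, A). RAct \<beta> ` B)" for \<alpha> A
    unfolding Dia_def by auto
  have "Dia (act_A T \<pi> \<alpha>) (act_F \<pi> A) =
      (\<Union>(N, \<beta>, B) \<in> act_set (act_npair act_AF) \<pi> (abstr act_AF (bn T \<alpha>) (\<alpha>, A)). RAct \<beta> ` B)"
    using act_abstr[OF nominal_ACT_preforms _ assms(3), of "(\<alpha>, A)" "bn T \<alpha>"] assms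
      bn_eqvt[OF assms(3,1)]
    by (simp add: Dia_alt act_set_def)
  also have "\<dots> = act_F \<pi> (Dia \<alpha> A)"
    unfolding Dia_alt act_set_def act_npair_def act_F_def act_pair_def
    by (simp add: image_UN image_image case_prod_beta)
  finally show ?thesis by simp
qed

lemma act_set_supports:
  assumes "\<pi> \<in> perms" "X \<subseteq> preforms" "supports (act_set act_F) S X"
  shows "supports (act_set act_F) (Perm.apply \<pi> ` S) (act_set act_F \<pi> X)"
proof (rule supports_act[where X = "Pow preforms"])
  show "act_set act_F 1 Y = Y" if "Y \<in> Pow preforms" for Y
    unfolding act_set_def using that nominal_one[OF nominal_preforms]
    by (intro trans[OF image_cong[OF refl] image_ident]) auto
qed (use assms act_set_mult[OF nominal_preforms] act_set_closed[OF nominal_preforms] in auto)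

lemma small_act_set:
  assumes "\<pi> \<in> perms" "X \<subseteq> preforms" "small X"
  shows "small (act_set act_F \<pi> X)"
proof -
  have "|act_set act_F \<pi> X| <o \<kappa>"
    using assms(3) card_of_image ordLeq_ordLess_trans unfolding small_def act_set_def by blast
  moreover have "fin_supp (act_set act_F) (act_set act_F \<pi> X)"
    using assms act_set_supports unfolding small_def fin_supp_def by (metis finite_imageI)
  ultimately show ?thesis by (simp add: small_def)
qed

text \<open>The equivariance laws of \<open>Conj\<close> and \<open>Dia\<close> require parts in
  \<open>preforms\<close>, so membership there and closure under permutations are carried through
  one induction.\<close>

lemma formulas_eqvt_preforms:
  "A \<in> formulas \<Longrightarrow> A \<in> preforms \<and> (\<forall>\<pi>\<in>perms. act_F \<pi> A \<in> formulas)"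
proof (induction rule: formulas.induct)
  case (1 X)
  then have X: "X \<subseteq> preforms" "X \<subseteq> formulas" by auto
  obtain S where S: "finite S" "supports (act_set act_F) S X"
    using 1(2) by (auto simp: small_def fin_supp_def)
  \<comment> \<open>A support of the set \<open>X\<close> is enough; the union of the supports of
    its members might be infinite.\<close>
  have "supports act_F S (Conj X)"
    using S(2) act_F_Conj X by (simp add: supports_def)
  moreover have "Conj X \<subseteq> trees" using X by (intro Conj_trees) (auto simp: preforms_def)
  moreover have "act_F \<pi> (Conj X) \<in> formulas" if "\<pi> \<in> perms" for \<pi>
    unfolding act_F_Conj[OF that X(1)]
    using 1 that small_act_set[OF that X(1)] by (intro formulas.intros(1)) (simp_all add: act_set_def, blast)
  ultimately show ?case using S(1) unfolding preforms_def fin_supp_def by blast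
next
  case (2 A)
  then obtain S where S: "finite S" "supports act_F S A" by (auto simp: preforms_def fin_supp_def)
  have "supports act_F S (Neg A)" using S(2) by (simp add: supports_def act_F_Neg)
  moreover have "Neg A \<subseteq> trees" using 2(2) by (fastforce simp: Neg_def preforms_def trees_def)
  ultimately have "Neg A \<in> preforms" using S(1) by (auto simp: preforms_def fin_supp_def)
  then show ?case using 2(2) by (simp add: act_F_Neg formulas.intros(2))
next
  case (3 \<phi>)
  obtain S where S: "finite S" "supports (act_P T) S \<phi>"
    using nominal_fin_supp[OF nominal_PRED 3] by (auto simp: fin_supp_def)
  have "supports act_F S (Pred \<phi>)" using S(2) by (simp add: supports_def act_F_Pred)
  moreover have "Pred \<phi> \<subseteq> trees" using 3 by (auto simp: Pred_def trees_def)
  ultimately have "Pred \<phi> \<in> preforms" using S(1) by (auto simp: preforms_def fin_supp_def)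
  then show ?case using 3 by (simp add: act_F_Pred formulas.intros(3) nominal_closed[OF nominal_PRED])
next
  case (4 \<alpha> A)
  have "supports act_F (supp act_AF (\<alpha>, A)) (Dia \<alpha> A)" "finite (supp act_AF (\<alpha>, A))"
    using supp_supports[OF nominal_ACT_preforms, of "(\<alpha>, A)"] 4 by (auto simp: supports_def act_F_Dia)
  moreover have "Dia \<alpha> A \<subseteq> trees"
  proof
    fix u assume "u \<in> Dia \<alpha> A"
    then obtain \<pi> t where "\<pi> \<in> perms" "u = RAct (act_A T \<pi> \<alpha>) t" "t \<in> act_F \<pi> A"
      unfolding mem_Dia_iff by blast
    moreover have "act_F \<pi> A \<in> preforms" if "\<pi> \<in> perms" for \<pi>
      using 4 that nominal_closed[OF nominal_preforms] by simp
    ultimately show "u \<in> trees"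
      using nominal_closed[OF nominal_ACT] 4 by (auto simp: preforms_def trees_def)
  qed
  moreover have "act_F \<pi> (Dia \<alpha> A) \<in> formulas" if "\<pi> \<in> perms" for \<pi>
    using 4 that by (simp add: act_F_Dia formulas.intros(4) nominal_closed[OF nominal_ACT])
  ultimately show ?case unfolding preforms_def fin_supp_def by blast
qed

lemma formulas_preforms: "A \<in> formulas \<Longrightarrow> A \<in> preforms"
  and act_F_formulas: "A \<in> formulas \<Longrightarrow> \<pi> \<in> perms \<Longrightarrow> act_F \<pi> A \<in> formulas"
  using formulas_eqvt_preforms by blast+

lemma nominal_formulas: "nominal_set formulas act_F"
  unfolding nominal_set_def
  by (auto simp: act_F_formulas formulas_preforms nominal_one[OF nominal_preforms]
      nominal_mult[OF nominal_preforms] nominal_fin_supp[OF nominal_preforms])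

lemma nominal_ACT_formulas: "nominal_set (ACT T \<times> formulas) act_AF"
  by (rule nominal_set_pair[OF nominal_ACT nominal_formulas])

text \<open>In a tree common to both sides, each member of \<open>X\<close> contains some child, and
  that child lies in a member of \<open>Y\<close>. The first hypothesis identifies the two members,
  and the converse is symmetric.\<close>

lemma Conj_meet_imp_eq:
  assumes "\<And>A B. A \<in> X \<Longrightarrow> B \<in> Y \<Longrightarrow> A \<inter> B \<noteq> {} \<Longrightarrow> A = B"
      "Conj X \<inter> Conj Y \<noteq> {}"
  shows "X = Y"
proof -
  obtain u where u: "u \<in> Conj X" "u \<in> Conj Y" using assms(2) by blast
  then obtain f where "u = RConj f" unfolding Conj_def by blast
  with u have f: "\<forall>t\<in>ran f. \<exists>A\<in>X. t \<in> A" "\<forall>A\<in>X. \<exists>t\<in>ran f. t \<in> A"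
      "\<forall>t\<in>ran f. \<exists>A\<in>Y. t \<in> A" "\<forall>A\<in>Y. \<exists>t\<in>ran f. t \<in> A"
    by (simp_all add: RConj_mem_Conj_iff)
  have "A \<in> Y" if A: "A \<in> X" for A
  proof -
    obtain t B where "t \<in> A" "B \<in> Y" "t \<in> B" using A f(2,3) by metis
    then have "A = B" using A by (intro assms(1)) auto
    then show ?thesis using \<open>B \<in> Y\<close> by simp
  qed
  moreover have "B \<in> X" if B: "B \<in> Y" for B
  proof -
    obtain t A where "t \<in> B" "A \<in> X" "t \<in> A" using B f(4,1) by metis
    then have "A = B" using B by (intro assms(1)) auto
    then show ?thesis using \<open>A \<in> X\<close> by simp
  qed
  ultimately show ?thesis by blast
qed

text \<open>The root of a common tree excludes different constructors, and its children reduce equal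
  constructors to the induction hypothesis.\<close>

lemma formulas_meet_imp_eq: "A \<in> formulas \<Longrightarrow> B \<in> formulas \<Longrightarrow> A \<inter> B \<noteq> {} \<Longrightarrow> A = B"
proof (induction arbitrary: B rule: formulas.induct)
  case (1 X)
  from 1(4) show ?case
  proof (cases rule: formulas.cases)
    case Y: (1 Y)
    have "A = B'" if "A \<in> X" "B' \<in> Y" "A \<inter> B' \<noteq> {}" for A B'
      using "1.IH"[OF that(1) Y(2)[OF that(2)] that(3)] .
    then have "X = Y" by (rule Conj_meet_imp_eq) (use 1(5) Y(1) in auto)
    then show ?thesis using Y(1) by simp
  qed (use 1(5) in \<open>auto simp: Conj_def Neg_def Pred_def Dia_def\<close>)
next
  case (2 A)
  from 2(3) show ?case
  proof (cases rule: formulas.cases)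
    case B: (2 B')
    have "A \<inter> B' \<noteq> {}" using 2(4) unfolding B(1) Neg_def by blast
    then show ?thesis using 2(2)[OF B(2)] B(1) by simp
  qed (use 2(4) in \<open>auto simp: Conj_def Neg_def Pred_def Dia_def\<close>)
next
  case (3 \<phi>)
  from 3(2) show ?case
    by (cases rule: formulas.cases) (use 3(3) in \<open>auto simp: Conj_def Neg_def Pred_def Dia_def\<close>)
next
  case (4 \<alpha> A)
  from 4(4) show ?case
  proof (cases rule: formulas.cases)
    case B: (4 \<beta> B')
    from 4(5) obtain u where "u \<in> Dia \<alpha> A" "u \<in> Dia \<beta> B'" unfolding B(1) by blast
    then obtain \<pi> \<rho> t where *:
      "\<pi> \<in> perms" "fixes_names \<pi> (supp act_AF (\<alpha>, A) - bn T \<alpha>)"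
      "\<rho> \<in> perms" "fixes_names \<rho> (supp act_AF (\<beta>, B') - bn T \<beta>)"
      "act_A T \<pi> \<alpha> = act_A T \<rho> \<beta>" "t \<in> act_F \<pi> A" "t \<in> act_F \<rho> B'"
      unfolding mem_Dia_iff by blast
    \<comment> \<open>The induction hypothesis compares a formula with \<open>A\<close> itself, not
      with a renaming of \<open>A\<close>; therefore the other body is renamed back by
      \<open>inverse \<pi>\<close>.\<close>
    let ?B = "act_F (inverse \<pi>) (act_F \<rho> B')"
    have fB: "act_F \<rho> B' \<in> formulas" "?B \<in> formulas" using *(1,3) B(3) by (simp_all add: act_F_formulas)
    have "act_R (inverse \<pi>) t \<in> act_F (inverse \<pi>) (act_F \<pi> A)" "act_R (inverse \<pi>) t \<in> ?B"
      using *(6,7) by (auto intro: act_F_mem)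
    then have "A \<inter> ?B \<noteq> {}" using nominal_inverse(1)[OF nominal_formulas *(1) 4(2)] by auto
    then have "A = ?B" by (rule 4(3)[OF fB(2)])
    then have "act_F \<pi> A = act_F \<rho> B'"
      using nominal_inverse(2)[OF nominal_formulas *(1) fB(1)] by simp
    then have "Dia (act_A T \<pi> \<alpha>) (act_F \<pi> A) = Dia (act_A T \<rho> \<beta>) (act_F \<rho> B')" using *(5) by simp
    then show ?thesis
      unfolding B(1) Dia_alpha[OF 4(1) formulas_preforms[OF 4(2)] *(1,2)]
        Dia_alpha[OF B(2) formulas_preforms[OF B(3)] *(3,4)] .
  qed (use 4(5) in \<open>auto simp: Conj_def Neg_def Pred_def Dia_def\<close>)
qed

text \<open>Membership of \<open>Conj X\<close> in \<open>formulas\<close> provides a tree common to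
  both sides. For arbitrary \<open>X\<close> the set \<open>Conj X\<close> may be empty, for example
  when the members are too many to be indexed by \<open>'k\<close>.\<close>

lemma Conj_eq_iff:
  assumes "Conj X \<in> formulas" "X \<subseteq> formulas" "Y \<subseteq> formulas"
  shows "Conj X = Conj Y \<longleftrightarrow> X = Y"
proof
  assume "Conj X = Conj Y"
  then have "Conj X \<inter> Conj Y \<noteq> {}" using formulas_nonempty[OF assms(1)] by simp
  then show "X = Y" by (rule Conj_meet_imp_eq[rotated]) (use assms formulas_meet_imp_eq in blast)
qed simp

lemma Neg_eq_iff: "Neg A = Neg B \<longleftrightarrow> A = B"
  unfolding Neg_def by (rule inj_image_eq_iff) (simp add: inj_on_def)

text \<open>For \<open>t\<close> in \<open>B\<close> the tree \<open>RAct \<beta> t\<close> also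
  lies in \<open>Dia \<alpha> A\<close>, which yields the renaming; \<open>t\<close> then shows that
  \<open>B\<close> meets the renamed \<open>A\<close>.\<close>

lemma Dia_eqD:
  assumes "Dia \<alpha> A = Dia \<beta> B" "\<beta> \<in> ACT T" "A \<in> formulas" "B \<in> formulas"
  obtains \<pi> where "\<pi> \<in> perms" "fixes_names \<pi> (supp act_AF (\<alpha>, A) - bn T \<alpha>)"
    "\<beta> = act_A T \<pi> \<alpha>" "B = act_F \<pi> A"
proof -
  obtain t where t: "t \<in> B" using formulas_nonempty[OF assms(4)] by blast
  have "RAct \<beta> t \<in> Dia \<beta> B"
    unfolding mem_Dia_iff using t assms
    by (intro bexI[of _ 1])
      (auto simp: fixes_names_def nominal_one[OF nominal_ACT] nominal_one[OF nominal_formulas])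
  then obtain \<pi> where \<pi>: "\<pi> \<in> perms" "fixes_names \<pi> (supp act_AF (\<alpha>, A) - bn T \<alpha>)"
      "\<beta> = act_A T \<pi> \<alpha>" "t \<in> act_F \<pi> A"
    unfolding assms(1)[symmetric] mem_Dia_iff by blast
  have "B = act_F \<pi> A"
    using t \<pi> assms act_F_formulas by (intro formulas_meet_imp_eq) auto
  then show thesis using that \<pi> by blast
qed

section \<open>Satisfaction\<close>

text \<open>The defining equation of \<open>sat\<close> ranges over all ways to write a formula. The
  roots of trees exclude the other constructors, and injectivity leaves only the given
  decomposition. The next three lemmas follow the same pattern.\<close>

lemma sat_Conj:
  assumes "Conj X \<in> formulas" "X \<subseteq> formulas"
  shows "P \<Turnstile> Conj X \<longleftrightarrow> (\<forall>A\<in>X. P \<Turnstile> A)"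
proof -
  obtain f where f: "RConj f \<in> Conj X" using formulas_nonempty[OF assms(1)] by (auto simp: Conj_def)
  then have "Conj X \<noteq> Neg A" "Conj X \<noteq> Pred \<phi>" "Conj X \<noteq> Dia \<alpha> A" for A \<phi> \<alpha>
    by (auto simp: Neg_def Pred_def Dia_def)
  moreover have "Y = X" if "Y \<subseteq> formulas" "Conj X = Conj Y" for Y
    using that Conj_eq_iff[OF assms, of Y] by simp
  ultimately show ?thesis unfolding sat.simps[of P "Conj X"] using assms by blast
qed

lemma sat_Neg:
  assumes "A \<in> formulas"
  shows "P \<Turnstile> Neg A \<longleftrightarrow> \<not> P \<Turnstile> A"
proof -
  have fA: "Neg A \<in> formulas" by (rule formulas.intros(2)[OF assms])
  obtain t where "RNeg t \<in> Neg A" using formulas_nonempty[OF fA] by (auto simp: Neg_def)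
  then have "Neg A \<noteq> Conj X" "Neg A \<noteq> Pred \<phi>" "Neg A \<noteq> Dia \<alpha> B" for X B \<phi> \<alpha>
    by (auto simp: Conj_def Pred_def Dia_def)
  moreover have "B = A" if "Neg A = Neg B" for B using that by (simp add: Neg_eq_iff)
  ultimately show ?thesis unfolding sat.simps[of P "Neg A"] using assms fA by blast
qed

lemma sat_Pred:
  assumes "\<phi> \<in> PRED T"
  shows "P \<Turnstile> Pred \<phi> \<longleftrightarrow> (P, \<phi>) \<in> entails T"
proof -
  have fA: "Pred \<phi> \<in> formulas" by (rule formulas.intros(3)[OF assms])
  have "RPred \<phi> \<in> Pred \<phi>" by (simp add: Pred_def)
  then have "Pred \<phi> \<noteq> Conj X" "Pred \<phi> \<noteq> Neg B" "Pred \<phi> \<noteq> Dia \<alpha> B" for X B \<alpha>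
    by (auto simp: Conj_def Neg_def Dia_def)
  moreover have "\<psi> = \<phi>" if "Pred \<phi> = Pred \<psi>" for \<psi> using that by (auto simp: Pred_def)
  ultimately show ?thesis unfolding sat.simps[of P "Pred \<phi>"] using assms fA by blast
qed

text \<open>By \<open>Dia_eqD\<close> every representative is a renaming of the given one, so the
  search for a fresh representative becomes a search for a permutation.\<close>

lemma sat_Dia:
  assumes "\<alpha> \<in> ACT T" "A \<in> formulas"
  shows "P \<Turnstile> Dia \<alpha> A \<longleftrightarrow> (\<exists>\<pi>\<in>perms. fixes_names \<pi> (supp act_AF (\<alpha>, A) - bn T \<alpha>) \<and>
    bn T (act_A T \<pi> \<alpha>) \<inter> supp (act_S T) P = {} \<and> (\<exists>P'. step P (act_A T \<pi> \<alpha>) P' \<and> P' \<Turnstile> act_F \<pi> A))"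
    (is "_ \<longleftrightarrow> ?R")
proof -
  have fA: "Dia \<alpha> A \<in> formulas" by (rule formulas.intros(4)[OF assms])
  obtain \<beta> t where "RAct \<beta> t \<in> Dia \<alpha> A" using formulas_nonempty[OF fA] by (auto simp: Dia_def)
  then have "Dia \<alpha> A \<noteq> Conj X" "Dia \<alpha> A \<noteq> Neg B" "Dia \<alpha> A \<noteq> Pred \<phi>" for X B \<phi>
    by (auto simp: Conj_def Neg_def Pred_def)
  then have *: "P \<Turnstile> Dia \<alpha> A \<longleftrightarrow> (\<exists>\<beta> B. \<beta> \<in> ACT T \<and> B \<in> formulas \<and> Dia \<alpha> A = Dia \<beta> B \<and>
      bn T \<beta> \<inter> supp (act_S T) P = {} \<and> (\<exists>P'. step P \<beta> P' \<and> P' \<Turnstile> B))"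
    unfolding sat.simps[of P "Dia \<alpha> A"] using fA by blast
  show ?thesis
  proof
    assume "P \<Turnstile> Dia \<alpha> A"
    then obtain \<beta> B P' where b: "\<beta> \<in> ACT T" "B \<in> formulas" "Dia \<alpha> A = Dia \<beta> B"
        "bn T \<beta> \<inter> supp (act_S T) P = {}" "step P \<beta> P'" "P' \<Turnstile> B"
      unfolding * by blast
    obtain \<pi> where "\<pi> \<in> perms" "fixes_names \<pi> (supp act_AF (\<alpha>, A) - bn T \<alpha>)"
        "\<beta> = act_A T \<pi> \<alpha>" "B = act_F \<pi> A"
      using Dia_eqD[OF b(3,1) assms(2) b(2)] by blast
    then show ?R using b by blast
  next
    assume ?R
    then obtain \<pi> P' where p: "\<pi> \<in> perms" "fixes_names \<pi> (supp act_AF (\<alpha>, A) - bn T \<alpha>)"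
        "bn T (act_A T \<pi> \<alpha>) \<inter> supp (act_S T) P = {}" "step P (act_A T \<pi> \<alpha>) P'"
            "P' \<Turnstile> act_F \<pi> A"
      by blast
    have "Dia \<alpha> A = Dia (act_A T \<pi> \<alpha>) (act_F \<pi> A)"
      using Dia_alpha[OF assms(1) formulas_preforms[OF assms(2)] p(1,2)] by simp
    moreover have "act_A T \<pi> \<alpha> \<in> ACT T" "act_F \<pi> A \<in> formulas"
      using p(1) assms nominal_closed[OF nominal_ACT] act_F_formulas by auto
    ultimately show "P \<Turnstile> Dia \<alpha> A" unfolding * using p by blast
  qed
qed

lemma sat_DiaI:
  assumes "\<alpha> \<in> ACT T" "A \<in> formulas" "bn T \<alpha> \<inter> supp (act_S T) P = {}" "step P \<alpha> P'"
      "P' \<Turnstile> A"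
  shows "P \<Turnstile> Dia \<alpha> A"
  unfolding sat_Dia[OF assms(1,2)] using assms
  by (intro bexI[of _ 1])
    (auto simp: fixes_names_def nominal_one[OF nominal_ACT] nominal_one[OF nominal_formulas])

section \<open>Equivariance of transitions and satisfaction\<close>

lemma step_eqvt:
  assumes "step P \<alpha> P'" "\<pi> \<in> perms"
  shows "step (act_S T \<pi> P) (act_A T \<pi> \<alpha>) (act_S T \<pi> P')"
proof -
  have c: "\<alpha> \<in> ACT T" "P' \<in> STATES T" using assms(1) by (auto simp: step_def)
  have "(act_S T \<pi> P, act_set (act_npair (act_pair (act_A T) (act_S T))) \<pi>
      (abstr (act_pair (act_A T) (act_S T)) (bn T \<alpha>) (\<alpha>, P'))) \<in> transitions T"
    using assms trans_eqvt by (auto simp: step_def)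
  then show ?thesis
    using c assms(2) bn_eqvt[OF assms(2) c(1)]
      act_abstr[OF nominal_set_pair[OF nominal_ACT nominal_STATES], of "(\<alpha>, P')" \<pi> "bn T \<alpha>"]
    by (simp add: step_def act_set_def nominal_closed[OF nominal_ACT] nominal_closed[OF nominal_STATES])
qed

lemma sat_eqvt:
  "A \<in> formulas \<Longrightarrow> \<pi> \<in> perms \<Longrightarrow> P \<in> STATES T \<Longrightarrow> act_S T \<pi> P \<Turnstile> act_F \<pi> A \<longleftrightarrow> P \<Turnstile> A"
proof (induction arbitrary: \<pi> P rule: formulas.induct)
  case (1 X)
  have X: "X \<subseteq> formulas" "X \<subseteq> preforms" using "1.hyps" formulas_preforms by auto
  have C: "Conj X \<in> formulas" using 1 by (intro formulas.intros(1))
  have e: "act_F \<pi> (Conj X) = Conj (act_set act_F \<pi> X)" by (rule act_F_Conj[OF 1(4) X(2)])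
  have "Conj (act_set act_F \<pi> X) \<in> formulas" using act_F_formulas[OF C 1(4)] e by simp
  then have "act_S T \<pi> P \<Turnstile> act_F \<pi> (Conj X) \<longleftrightarrow> (\<forall>A\<in>X. act_S T \<pi> P \<Turnstile> act_F \<pi> A)"
    unfolding e using act_set_closed[OF nominal_formulas 1(4) X(1)]
    by (simp add: sat_Conj act_set_def)
  then show ?case using 1 by (simp add: sat_Conj[OF C X(1)])
next
  case (2 A)
  then show ?case by (simp add: act_F_Neg sat_Neg act_F_formulas)
next
  case (3 \<phi>)
  have "(P, \<phi>) \<in> entails T" if "(act_S T \<pi> P, act_P T \<pi> \<phi>) \<in> entails T"
    using entails_eqvt[OF perms_inverse[OF 3(2)] that] 3
    by (simp add: nominal_inverse[OF nominal_STATES] nominal_inverse[OF nominal_PRED])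
  then show ?case using 3 entails_eqvt[OF 3(2)]
    by (auto simp: act_F_Pred sat_Pred nominal_closed[OF nominal_PRED])
next
  case (4 \<alpha> A)
  \<comment> \<open>The renaming \<open>\<sigma>\<close> of the body is left free, so that both
    directions are instances: \<open>\<sigma> = 1\<close> gives one, and
    \<open>\<sigma> = \<pi>\<close> under the action of \<open>inverse \<pi>\<close> gives the
    other.\<close>
  have claim: "act_S T \<pi> P \<Turnstile> act_F \<pi> (Dia (act_A T \<sigma> \<alpha>) (act_F \<sigma> A))"
    if h: "\<pi> \<in> perms" "\<sigma> \<in> perms" "P \<in> STATES T"
        "P \<Turnstile> Dia (act_A T \<sigma> \<alpha>) (act_F \<sigma> A)" for \<pi> \<sigma> P
  proof -
    let ?\<alpha> = "act_A T \<sigma> \<alpha>" and ?A = "act_F \<sigma> A"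
    have c: "?\<alpha> \<in> ACT T" "?A \<in> formulas"
      using h 4 nominal_closed[OF nominal_ACT] act_F_formulas by auto
    obtain \<rho> P' where r: "\<rho> \<in> perms" "fixes_names \<rho> (supp act_AF (?\<alpha>, ?A) - bn T ?\<alpha>)"
      "bn T (act_A T \<rho> ?\<alpha>) \<inter> supp (act_S T) P = {}" "step P (act_A T \<rho> ?\<alpha>) P'"
          "P' \<Turnstile> act_F \<rho> ?A"
      using h(4) unfolding sat_Dia[OF c] by blast
    let ?\<beta> = "act_A T \<rho> ?\<alpha>" and ?B = "act_F \<rho> ?A"
    have cB: "?\<beta> \<in> ACT T" "?B \<in> formulas" "P' \<in> STATES T"
      using r(1,4) c nominal_closed[OF nominal_ACT] act_F_formulas by (auto simp: step_def)
    have "act_S T \<pi> P \<Turnstile> Dia (act_A T \<pi> ?\<beta>) (act_F \<pi> ?B)"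
    proof (rule sat_DiaI)
      show "act_A T \<pi> ?\<beta> \<in> ACT T" "act_F \<pi> ?B \<in> formulas"
        using cB h nominal_closed[OF nominal_ACT] act_F_formulas by auto
      have "bn T (act_A T \<pi> ?\<beta>) \<inter> supp (act_S T) (act_S T \<pi> P) =
          Perm.apply \<pi> ` (bn T ?\<beta> \<inter> supp (act_S T) P)"
        using bn_eqvt[OF h(1) cB(1)] supp_act[OF nominal_STATES h(1,3)]
        by (simp add: act_set_def image_Int bij_is_inj)
      then show "bn T (act_A T \<pi> ?\<beta>) \<inter> supp (act_S T) (act_S T \<pi> P) = {}" using r(3) by simp
      show "step (act_S T \<pi> P) (act_A T \<pi> ?\<beta>) (act_S T \<pi> P')" by (rule step_eqvt[OF r(4) h(1)])
      \<comment> \<open>The induction hypothesis speaks only of permutations applied to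
        \<open>A\<close>. Pulling \<open>P'\<close> back along \<open>\<rho> * \<sigma>\<close>
        reduces both satisfaction claims to \<open>?Q \<Turnstile> A\<close>.\<close>
      let ?Q = "act_S T (inverse (\<rho> * \<sigma>)) P'"
      have Q: "?Q \<in> STATES T" using cB(3) r(1) h(2) by (simp add: nominal_closed[OF nominal_STATES])
      have p: "\<rho> * \<sigma> \<in> perms" "\<pi> * (\<rho> * \<sigma>) \<in> perms" using r(1) h by simp_all
      have e: "act_S T (\<rho> * \<sigma>) ?Q = P'" by (rule nominal_inverse(2)[OF nominal_STATES p(1) cB(3)])
      have B: "act_F (\<rho> * \<sigma>) A = ?B" by (rule nominal_mult[OF nominal_formulas r(1) h(2) 4(2)])
      have "P' \<Turnstile> ?B \<longleftrightarrow> ?Q \<Turnstile> A" using "4.IH"[OF p(1) Q] unfolding e B .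
      moreover have "act_S T \<pi> P' \<Turnstile> act_F \<pi> ?B \<longleftrightarrow> ?Q \<Turnstile> A"
        using "4.IH"[OF p(2) Q] unfolding nominal_mult[OF nominal_STATES h(1) p(1) Q] e
          nominal_mult[OF nominal_formulas h(1) p(1) 4(2)] B .
      ultimately show "act_S T \<pi> P' \<Turnstile> act_F \<pi> ?B" using r(5) by simp
    qed
    then show ?thesis
      using act_F_Dia[OF cB(1) formulas_preforms[OF cB(2)] h(1)]
        Dia_alpha[OF c(1) formulas_preforms[OF c(2)] r(1,2)] by simp
  qed
  have D: "Dia \<alpha> A \<in> formulas" using 4 by (intro formulas.intros(4))
  show ?case
  proof
    assume "P \<Turnstile> Dia \<alpha> A"
    then show "act_S T \<pi> P \<Turnstile> act_F \<pi> (Dia \<alpha> A)"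
      using claim[OF 4(4) perms_one 4(5)] 4(1,2)
      by (simp add: nominal_one[OF nominal_ACT] nominal_one[OF nominal_formulas])
  next
    assume *: "act_S T \<pi> P \<Turnstile> act_F \<pi> (Dia \<alpha> A)"
    have e: "act_F \<pi> (Dia \<alpha> A) = Dia (act_A T \<pi> \<alpha>) (act_F \<pi> A)"
      by (rule act_F_Dia[OF 4(1) formulas_preforms[OF 4(2)] 4(4)])
    have "act_S T (inverse \<pi>) (act_S T \<pi> P) \<Turnstile> act_F (inverse \<pi>) (act_F \<pi> (Dia \<alpha> A))"
      unfolding e by (rule claim) (use 4 * e nominal_closed[OF nominal_STATES] in auto)
    then show "P \<Turnstile> Dia \<alpha> A"
      using 4(4,5) D by (simp add: nominal_inverse[OF nominal_STATES] nominal_inverse[OF nominal_formulas])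
  qed
qed

text \<open>A permutation that fixes \<open>P\<close> and undoes the renaming of \<open>bn \<alpha>\<close> carries a witness for one
  representative to a witness for the other.\<close>

lemma sat_Dia_fresh:
  assumes \<alpha>: "\<alpha> \<in> ACT T" and A: "A \<in> formulas" and P: "P \<in> STATES T"
    and fresh: "bn T \<alpha> \<inter> supp (act_S T) P = {}"
  shows "P \<Turnstile> Dia \<alpha> A \<longleftrightarrow> (\<exists>P'. step P \<alpha> P' \<and> P' \<Turnstile> A)"
proof
  assume "P \<Turnstile> Dia \<alpha> A"
  then obtain \<pi> P' where p: "\<pi> \<in> perms" "fixes_names \<pi> (supp act_AF (\<alpha>, A) - bn T \<alpha>)"
      "bn T (act_A T \<pi> \<alpha>) \<inter> supp (act_S T) P = {}" "step P (act_A T \<pi> \<alpha>) P'"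
          "P' \<Turnstile> act_F \<pi> A"
    unfolding sat_Dia[OF \<alpha> A] by blast
  let ?K = "supp (act_S T) P \<union> (supp act_AF (\<alpha>, A) - bn T \<alpha>)"
  have bn: "bn T (act_A T \<pi> \<alpha>) = Perm.apply \<pi> ` bn T \<alpha>"
    using bn_eqvt[OF p(1) \<alpha>] by (simp add: act_set_def)
  \<comment> \<open>A renamed bound name cannot be captured by a free name: \<open>\<pi>\<close>
    fixes the free names and is injective.\<close>
  have "Perm.apply \<pi> a \<notin> supp act_AF (\<alpha>, A) - bn T \<alpha>" if "a \<in> bn T \<alpha>" for a
  proof
    assume *: "Perm.apply \<pi> a \<in> supp act_AF (\<alpha>, A) - bn T \<alpha>"
    then have "Perm.apply \<pi> (Perm.apply \<pi> a) = Perm.apply \<pi> a" using p(2) by (simp add: fixes_names_def)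
    then show False using * that by (simp add: apply_inj)
  qed
  then have 1: "Perm.apply \<pi> ` bn T \<alpha> \<inter> ?K = {}" using p(3) unfolding bn by blast
  have img: "Perm.apply (inverse \<pi>) ` Perm.apply \<pi> ` bn T \<alpha> = bn T \<alpha>" by (simp add: image_image)
  have 2: "Perm.apply (inverse \<pi>) ` Perm.apply \<pi> ` bn T \<alpha> \<inter> ?K = {}" unfolding img using fresh by blast
  obtain \<rho> where \<rho>: "\<rho> \<in> perms" "fixes_names \<rho> ?K"
      "\<And>d. d \<in> Perm.apply \<pi> ` bn T \<alpha> \<Longrightarrow> Perm.apply \<rho> d = Perm.apply (inverse \<pi>) d"
    using extend_perm[OF finite_imageI[OF bn_finite[OF \<alpha>]] perms_inverse[OF p(1)] 1 2] by blast
  \<comment> \<open>On \<open>bn T \<alpha>\<close> the permutation \<open>\<rho>\<close> undoes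
    \<open>\<pi>\<close>; on the remaining names of the support both factors are the
    identity.\<close>
  have "fixes_names (\<rho> * \<pi>) (supp act_AF (\<alpha>, A))"
    unfolding fixes_names_def apply_times comp_apply
  proof
    fix a assume "a \<in> supp act_AF (\<alpha>, A)"
    then show "Perm.apply \<rho> (Perm.apply \<pi> a) = a"
      using \<rho>(2,3) p(2) by (cases "a \<in> bn T \<alpha>") (auto simp: fixes_names_def)
  qed
  then have "act_AF (\<rho> * \<pi>) (\<alpha>, A) = (\<alpha>, A)"
    using \<rho>(1) p(1) \<alpha> A by (intro act_supp_fixed[OF nominal_ACT_formulas]) auto
  then have e: "act_A T \<rho> (act_A T \<pi> \<alpha>) = \<alpha>" "act_F \<rho> (act_F \<pi> A) = A"
    using \<rho>(1) p(1) \<alpha> A by (simp_all add: nominal_mult[OF nominal_ACT] nominal_mult[OF nominal_formulas])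
  have "fixes_names \<rho> (supp (act_S T) P)" using \<rho>(2) by (simp add: fixes_names_def)
  then have "act_S T \<rho> P = P" by (rule act_supp_fixed[OF nominal_STATES P \<rho>(1)])
  then have "step P \<alpha> (act_S T \<rho> P')" using step_eqvt[OF p(4) \<rho>(1)] e by simp
  moreover have "act_S T \<rho> P' \<Turnstile> A"
    using sat_eqvt[OF act_F_formulas[OF A p(1)] \<rho>(1), of P'] p(4,5) e(2) by (simp add: step_def)
  ultimately show "\<exists>P'. step P \<alpha> P' \<and> P' \<Turnstile> A" by blast
qed (use sat_DiaI[OF \<alpha> A fresh] in blast)

definition equivalent :: "('k, 'a, 'p) form \<Rightarrow> ('k, 'a, 'p) form \<Rightarrow> bool" where
  "equivalent A B \<longleftrightarrow> (\<forall>P\<in>STATES T. P \<Turnstile> A \<longleftrightarrow> P \<Turnstile> B)"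

lemma equivalent_act:
  assumes "equivalent A B" "A \<in> formulas" "B \<in> formulas" "\<pi> \<in> perms"
  shows "equivalent (act_F \<pi> A) (act_F \<pi> B)"
  unfolding equivalent_def
proof
  fix P assume P: "P \<in> STATES T"
  let ?Q = "act_S T (inverse \<pi>) P"
  have Q: "?Q \<in> STATES T" using P assms(4) by (simp add: nominal_closed[OF nominal_STATES])
  have e: "act_S T \<pi> ?Q = P" by (rule nominal_inverse(2)[OF nominal_STATES assms(4) P])
  show "P \<Turnstile> act_F \<pi> A \<longleftrightarrow> P \<Turnstile> act_F \<pi> B"
    using sat_eqvt[OF assms(2,4) Q] sat_eqvt[OF assms(3,4) Q] assms(1) Q unfolding e
    by (simp add: equivalent_def)
qed

text \<open>Equivalent formulas may have different supports, so their representatives cannot be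
  matched blindly. A single \<open>\<pi>\<close> fixing the free names of both diamonds and moving
  \<open>bn T \<alpha>\<close> off the support of \<open>P\<close> lets both be evaluated along the
  same transitions.\<close>

lemma equivalent_Dia:
  assumes "equivalent A B" and \<alpha>: "\<alpha> \<in> ACT T" and A: "A \<in> formulas" and B: "B \<in> formulas"
  shows "equivalent (Dia \<alpha> A) (Dia \<alpha> B)"
  unfolding equivalent_def
proof
  fix P assume P: "P \<in> STATES T"
  let ?K = "(supp act_AF (\<alpha>, A) \<union> supp act_AF (\<alpha>, B)) - bn T \<alpha>"
  have "finite ?K"
    using supp_supports(1)[OF nominal_ACT_formulas] \<alpha> A B by simp
  then obtain \<pi> where \<pi>: "\<pi> \<in> perms" "fixes_names \<pi> ?K"
      "Perm.apply \<pi> ` bn T \<alpha> \<inter> supp (act_S T) P = {}"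
    using move_off[OF bn_finite[OF \<alpha>] _ supp_supports(1)[OF nominal_STATES P], of ?K] by blast
  have fresh: "bn T (act_A T \<pi> \<alpha>) \<inter> supp (act_S T) P = {}"
    using \<pi>(3) bn_eqvt[OF \<pi>(1) \<alpha>] by (simp add: act_set_def)
  have c: "act_A T \<pi> \<alpha> \<in> ACT T" by (rule nominal_closed[OF nominal_ACT \<pi>(1) \<alpha>])
  have *: "P \<Turnstile> Dia \<alpha> C \<longleftrightarrow> (\<exists>P'. step P (act_A T \<pi> \<alpha>) P' \<and> P' \<Turnstile> act_F \<pi> C)"
    if C: "C \<in> formulas" and "supp act_AF (\<alpha>, C) - bn T \<alpha> \<subseteq> ?K" for C
  proof -
    have "fixes_names \<pi> (supp act_AF (\<alpha>, C) - bn T \<alpha>)"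
      using that(2) \<pi>(2) unfolding fixes_names_def by blast
    then show ?thesis
      using Dia_alpha[OF \<alpha> formulas_preforms[OF C] \<pi>(1)]
        sat_Dia_fresh[OF c act_F_formulas[OF C \<pi>(1)] P fresh] by simp
  qed
  have "P' \<Turnstile> act_F \<pi> A \<longleftrightarrow> P' \<Turnstile> act_F \<pi> B"
      if "step P (act_A T \<pi> \<alpha>) P'" for P'
    using equivalent_act[OF assms(1) A B \<pi>(1)] that by (auto simp: equivalent_def step_def)
  moreover have "supp act_AF (\<alpha>, A) - bn T \<alpha> \<subseteq> ?K" "supp act_AF (\<alpha>, B) - bn T \<alpha> \<subseteq> ?K"
      by auto
  ultimately show "P \<Turnstile> Dia \<alpha> A \<longleftrightarrow> P \<Turnstile> Dia \<alpha> B"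
      using *[OF A] *[OF B] by blast
qed

section \<open>The silent action\<close>

lemma act_tau: "\<pi> \<in> perms \<Longrightarrow> act_A T \<pi> (tau T) = tau T"
  by (rule act_supp_fixed[OF nominal_ACT tau_ACT]) (simp_all add: supp_tau fixes_names_def)

lemma bn_tau: "bn T (tau T) = {}"
  using bn_supp[OF tau_ACT] supp_tau by simp

lemma sat_Dia_tau:
  "A \<in> formulas \<Longrightarrow> P \<in> STATES T \<Longrightarrow> P \<Turnstile> Dia (tau T) A \<longleftrightarrow> (\<exists>P'. step P (tau T) P' \<and> P' \<Turnstile> A)"
  by (rule sat_Dia_fresh[OF tau_ACT]) (simp_all add: bn_tau)

section \<open>Derived connectives\<close>

text \<open>A support of \<open>X\<close> together with \<open>S\<close> supports the image.
  Equivariance is asked only for permutations fixing \<open>S\<close>, so that \<open>f\<close> may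
  depend on a parameter with finitely many names, such as the weak formula \<open>A\<close> in
  \<open>weakly_predefinable_Disj\<close>.\<close>

lemma small_image:
  assumes "small X" "finite S"
    and eqvt: "\<And>\<pi> A. \<pi> \<in> perms \<Longrightarrow> fixes_names \<pi> S \<Longrightarrow> A \<in> X \<Longrightarrow> f (act_F \<pi> A) = act_F \<pi> (f A)"
  shows "small (f ` X)"
proof -
  obtain S' where S': "finite S'" "supports (act_set act_F) S' X"
    using assms(1) by (auto simp: small_def fin_supp_def)
  have "supports (act_set act_F) (S \<union> S') (f ` X)"
    unfolding supports_def
  proof (intro ballI impI)
    fix \<pi> assume \<pi>: "\<pi> \<in> perms" "fixes_names \<pi> (S \<union> S')"
    then have "fixes_names \<pi> S" "fixes_names \<pi> S'" by (auto simp: fixes_names_def)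
    then have "act_F \<pi> ` X = X" using S'(2) \<pi>(1) by (simp add: supports_def act_set_def)
    moreover have "act_set act_F \<pi> (f ` X) = f ` act_F \<pi> ` X"
      unfolding act_set_def image_image
      by (rule image_cong) (simp_all add: eqvt \<pi>(1) \<open>fixes_names \<pi> S\<close>)
    ultimately show "act_set act_F \<pi> (f ` X) = f ` X" by simp
  qed
  moreover have "|f ` X| <o \<kappa>"
    using assms(1) card_of_image ordLeq_ordLess_trans unfolding small_def by blast
  ultimately show ?thesis using S'(1) assms(2) unfolding small_def fin_supp_def by blast
qed

text \<open>Countable sets are admissible because \<open>\<kappa>\<close> is uncountable, and a
  support shared by all members supports the set. This makes the disjunction in
  \<open>WDia_tau\<close> legitimate.\<close>

lemma small_fixed:
  assumes "countable X" "finite S"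
    and "\<And>\<pi> A. \<pi> \<in> perms \<Longrightarrow> fixes_names \<pi> S \<Longrightarrow> A \<in> X \<Longrightarrow> act_F \<pi> A = A"
  shows "small X"
proof -
  obtain h :: "('k, 'a, 'p) form \<Rightarrow> nat" where "inj_on h X" using assms(1) by (rule countableE)
  then have "|X| \<le>o |UNIV :: nat set|" by (rule card_of_ordLeqI) simp
  then have "|X| \<le>o natLeq" using card_of_nat by (rule ordLeq_ordIso_trans)
  then have "|X| <o \<kappa>" using kappa_uncountable ordLeq_ordLess_trans by blast
  moreover have "supports (act_set act_F) S X"
    unfolding supports_def act_set_def using assms(3) by simp
  ultimately show ?thesis using assms(2) unfolding small_def fin_supp_def by blast
qed

lemma small_finite:
  assumes "finite X" "X \<subseteq> formulas"
  shows "small X"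
proof (rule small_fixed)
  show "finite (\<Union>A\<in>X. supp act_F A)"
    using assms supp_supports(1)[OF nominal_formulas] by auto
  show "act_F \<pi> A = A" if "\<pi> \<in> perms" "fixes_names \<pi> (\<Union>A\<in>X. supp act_F A)" "A \<in> X" for \<pi> A
    using that assms(2) by (intro act_supp_fixed[OF nominal_formulas]) (auto simp: fixes_names_def)
qed (simp add: assms countable_finite)

lemma small_Neg: "small X \<Longrightarrow> small (Neg ` X)"
  by (rule small_image[of X "{}"]) (simp_all add: act_F_Neg)

lemma Conj_formulas: "X \<subseteq> formulas \<Longrightarrow> small X \<Longrightarrow> Conj X \<in> formulas"
  by (rule formulas.intros(1)) auto

lemma Neg_formulas: "X \<subseteq> formulas \<Longrightarrow> Neg ` X \<subseteq> formulas"
  by (auto intro: formulas.intros(2))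

lemma Disj_formulas: "X \<subseteq> formulas \<Longrightarrow> small X \<Longrightarrow> Disj X \<in> formulas"
  unfolding Disj_def by (intro formulas.intros(2) Conj_formulas Neg_formulas small_Neg)

lemma sat_Disj:
  assumes "X \<subseteq> formulas" "small X"
  shows "P \<Turnstile> Disj X \<longleftrightarrow> (\<exists>A\<in>X. P \<Turnstile> A)"
proof -
  have C: "Conj (Neg ` X) \<in> formulas" using assms by (intro Conj_formulas Neg_formulas small_Neg)
  have "P \<Turnstile> Disj X \<longleftrightarrow> \<not> (\<forall>A\<in>X. P \<Turnstile> Neg A)"
    unfolding Disj_def sat_Neg[OF C] sat_Conj[OF C Neg_formulas[OF assms(1)]] by simp
  also have "\<dots> \<longleftrightarrow> (\<exists>A\<in>X. P \<Turnstile> A)" using assms(1) sat_Neg by blast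
  finally show ?thesis .
qed

lemma act_F_Disj:
  assumes "X \<subseteq> formulas" "\<pi> \<in> perms"
  shows "act_F \<pi> (Disj X) = Disj (act_set act_F \<pi> X)"
proof -
  have "Neg ` X \<subseteq> preforms" using Neg_formulas[OF assms(1)] formulas_preforms by blast
  then show ?thesis
    using assms(2) by (simp add: Disj_def act_F_Neg act_F_Conj act_set_def image_image)
qed

lemma Disj_eq_iff:
  assumes "X \<subseteq> formulas" "small X" "Y \<subseteq> formulas"
  shows "Disj X = Disj Y \<longleftrightarrow> X = Y"
proof -
  have "inj Neg" by (simp add: inj_on_def Neg_eq_iff)
  moreover have "Conj (Neg ` X) \<in> formulas" using assms by (intro Conj_formulas Neg_formulas small_Neg)
  ultimately show ?thesis
    unfolding Disj_def Neg_eq_iff using Conj_eq_iff Neg_formulas assms by (simp add: inj_image_eq_iff)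
qed

lemma And_formulas: "A \<in> formulas \<Longrightarrow> B \<in> formulas \<Longrightarrow> And A B \<in> formulas"
  unfolding And_def by (intro Conj_formulas small_finite) auto

lemma sat_And: "A \<in> formulas \<Longrightarrow> B \<in> formulas \<Longrightarrow> P \<Turnstile> And A B \<longleftrightarrow> P \<Turnstile> A \<and> P \<Turnstile> B"
  using And_formulas sat_Conj[of "{A, B}"] by (simp add: And_def)

lemma act_F_And:
  "A \<in> formulas \<Longrightarrow> B \<in> formulas \<Longrightarrow> \<pi> \<in> perms \<Longrightarrow> act_F \<pi> (And A B) = And (act_F \<pi> A) (act_F \<pi> B)"
  by (simp add: And_def act_F_Conj formulas_preforms act_set_def)

text \<open>\<open>And\<close> is the conjunction of a set with at most two members, so the order of
  the conjuncts is not recoverable.\<close>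

lemma And_eqD:
  assumes "And A B = And A' B'" "A \<in> formulas" "B \<in> formulas" "A' \<in> formulas" "B' \<in> formulas"
  shows "{A, B} = {A', B'}"
proof -
  have "Conj {A, B} \<in> formulas" using And_formulas assms by (simp add: And_def)
  then show ?thesis using Conj_eq_iff[of "{A, B}" "{A', B'}"] assms by (simp add: And_def)
qed

section \<open>Iterated and weak diamonds\<close>

lemma Dia_tau_power_formulas: "A \<in> formulas \<Longrightarrow> (Dia (tau T) ^^ i) A \<in> formulas"
  by (induction i) (simp_all add: formulas.intros(4) tau_ACT)

lemma act_F_Dia_tau_power:
  "A \<in> formulas \<Longrightarrow> \<pi> \<in> perms \<Longrightarrow> act_F \<pi> ((Dia (tau T) ^^ i) A) = (Dia (tau T) ^^ i) (act_F \<pi> A)"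
  by (induction i) (simp_all add: act_F_Dia tau_ACT act_tau formulas_preforms Dia_tau_power_formulas)

lemma Dia_tau_powers:
  assumes "A \<in> formulas"
  shows "range (\<lambda>i. (Dia (tau T) ^^ i) A) \<subseteq> formulas" "small (range (\<lambda>i. (Dia (tau T) ^^ i) A))"
proof -
  show "range (\<lambda>i. (Dia (tau T) ^^ i) A) \<subseteq> formulas" using Dia_tau_power_formulas[OF assms] by blast
  show "small (range (\<lambda>i. (Dia (tau T) ^^ i) A))"
  proof (rule small_fixed)
    show "finite (supp act_F A)" by (rule supp_supports(1)[OF nominal_formulas assms])
  next
    fix \<pi> B assume "\<pi> \<in> perms" "fixes_names \<pi> (supp act_F A)" "B \<in> range (\<lambda>i. (Dia (tau T) ^^ i) A)"
    then show "act_F \<pi> B = B"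
      using act_F_Dia_tau_power assms act_supp_fixed[OF nominal_formulas] by auto
  qed simp
qed

lemma WDia_tau_formulas: "A \<in> formulas \<Longrightarrow> WDia_tau A \<in> formulas"
  unfolding WDia_tau_def by (intro Disj_formulas Dia_tau_powers)

lemma WDia_formulas: "\<alpha> \<in> ACT T \<Longrightarrow> A \<in> formulas \<Longrightarrow> WDia \<alpha> A \<in> formulas"
  by (simp add: WDia_def WDia_tau_formulas formulas.intros(4))

lemma act_F_WDia_tau: "A \<in> formulas \<Longrightarrow> \<pi> \<in> perms \<Longrightarrow> act_F \<pi> (WDia_tau A) = WDia_tau (act_F \<pi> A)"
  by (simp add: WDia_tau_def act_F_Disj Dia_tau_powers act_set_def image_image act_F_Dia_tau_power)

text \<open>The case split in \<open>WDia\<close> is stable under permutations, since every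
  permutation fixes \<open>tau T\<close> and acts injectively on actions.\<close>

lemma act_F_WDia:
  assumes "\<alpha> \<in> ACT T" "A \<in> formulas" "\<pi> \<in> perms"
  shows "act_F \<pi> (WDia \<alpha> A) = WDia (act_A T \<pi> \<alpha>) (act_F \<pi> A)"
proof (cases "\<alpha> = tau T")
  case True
  then show ?thesis using assms by (simp add: WDia_def act_tau act_F_WDia_tau)
next
  case False
  then have "act_A T \<pi> \<alpha> \<noteq> tau T"
    using nominal_act_eq_iff[OF nominal_ACT assms(3,1) tau_ACT] act_tau[OF assms(3)] by simp
  then show ?thesis
    using False assms
    by (simp add: WDia_def act_F_WDia_tau act_F_Dia formulas_preforms WDia_tau_formulas formulas.intros(4))
qed

lemma sat_Dia_tau_power:
  "A \<in> formulas \<Longrightarrow> P \<in> STATES T \<Longrightarrow>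
    P \<Turnstile> (Dia (tau T) ^^ i) A \<longleftrightarrow> (\<exists>P'. ((\<lambda>P P'. step P (tau T) P') ^^ i) P P' \<and> P' \<Turnstile> A)"
proof (induction i arbitrary: P)
  case (Suc i)
  have "P \<Turnstile> (Dia (tau T) ^^ Suc i) A \<longleftrightarrow> (\<exists>Q. step P (tau T) Q \<and> Q \<Turnstile> (Dia (tau T) ^^ i) A)"
    using sat_Dia_tau[OF Dia_tau_power_formulas[OF Suc(2)] Suc(3)] by simp
  also have "\<dots> \<longleftrightarrow> (\<exists>Q. step P (tau T) Q \<and> (\<exists>P'. ((\<lambda>P P'. step P (tau T) P') ^^ i) Q P' \<and> P' \<Turnstile> A))"
    using Suc(1)[OF Suc(2)] by (auto simp: step_def)
  also have "\<dots> \<longleftrightarrow> (\<exists>P'. ((\<lambda>P P'. step P (tau T) P') ^^ Suc i) P P' \<and> P' \<Turnstile> A)"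
    unfolding relpowp.simps relpowp_commute[symmetric] relcompp_apply by blast
  finally show ?case .
qed auto

lemma sat_WDia_tau:
  assumes "A \<in> formulas" "P \<in> STATES T"
  shows "P \<Turnstile> WDia_tau A \<longleftrightarrow> (\<exists>P'\<in>STATES T. (\<lambda>P P'. step P (tau T) P')\<^sup>*\<^sup>* P P' \<and> P' \<Turnstile> A)"
proof -
  have "P' \<in> STATES T" if "(\<lambda>P P'. step P (tau T) P')\<^sup>*\<^sup>* P P'" for P'
    using that assms(2) by (induction rule: rtranclp_induct) (auto simp: step_def)
  moreover have "P \<Turnstile> WDia_tau A \<longleftrightarrow> (\<exists>i. P \<Turnstile> (Dia (tau T) ^^ i) A)"
    unfolding WDia_tau_def sat_Disj[OF Dia_tau_powers[OF assms(1)]] by blast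
  ultimately show ?thesis
    unfolding sat_Dia_tau_power[OF assms] rtranclp_power by blast
qed

lemma equivalent_WDia_tau:
  "equivalent A B \<Longrightarrow> A \<in> formulas \<Longrightarrow> B \<in> formulas \<Longrightarrow> equivalent (WDia_tau A) (WDia_tau B)"
  by (simp add: equivalent_def sat_WDia_tau)

lemma equivalent_WDia:
  "equivalent A B \<Longrightarrow> \<alpha> \<in> ACT T \<Longrightarrow> A \<in> formulas \<Longrightarrow> B \<in> formulas \<Longrightarrow> equivalent (WDia \<alpha> A) (WDia \<alpha> B)"
  by (simp add: WDia_def equivalent_WDia_tau equivalent_Dia WDia_tau_formulas formulas.intros(4))

text \<open>Equal sets of powers make each of \<open>A\<close> and \<open>B\<close> an iterated
  diamond of the other. So \<open>B\<close> is an iterated diamond of itself, and well-foundedness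
  leaves only the zeroth power.\<close>

lemma WDia_tau_eqD:
  assumes "WDia_tau A = WDia_tau B" "A \<in> formulas" "B \<in> formulas"
  shows "A = B"
proof -
  let ?D = "\<lambda>i. Dia (tau T) ^^ i"
  have eq: "range (\<lambda>i. ?D i A) = range (\<lambda>i. ?D i B)"
    using assms(1) unfolding WDia_tau_def
    by (simp only: Disj_eq_iff Dia_tau_powers assms(2,3))
  have "?D 0 A \<in> range (\<lambda>i. ?D i B)" "?D 0 B \<in> range (\<lambda>i. ?D i A)"
    using eq rangeI[of "\<lambda>i. ?D i A" 0] rangeI[of "\<lambda>i. ?D i B" 0] by simp_all
  then obtain i j where i: "A = ?D i B" and j: "B = ?D j A" by (auto simp only: image_iff funpow_0)
  \<comment> \<open>The termination relation of \<open>sat\<close> serves as a strict subformula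
    order; \<open>undefined\<close> fills its state slot, and \<open>Suc n\<close> ensures at least
    one diamond.\<close>
  have "((undefined, B), (undefined, ?D (Suc n) B)) \<in> form_rel\<^sup>+" for n
  proof (induction n)
    case 0
    then show ?case
      using form_rel_Dia[of "tau T" B] Dia_tau_power_formulas[OF assms(3), of 1] by auto
  next
    case (Suc n)
    have "((undefined, ?D (Suc n) B), (undefined, ?D (Suc (Suc n)) B)) \<in> form_rel"
      using form_rel_Dia[of "tau T" "?D (Suc n) B"] Dia_tau_power_formulas[OF assms(3), of "Suc (Suc n)"]
      by simp
    with Suc show ?case by (rule trancl_into_trancl)
  qed
  then have "?D (Suc n) B \<noteq> B" for n
    using wf_not_refl[OF wf_trancl[OF wf_form_rel]] by metis
  moreover have "B = ?D (j + i) B" using i j by (simp add: funpow_add)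
  ultimately have "i = 0" by (metis add_is_0 not0_implies_Suc)
  then show ?thesis using i by simp
qed

section \<open>Translation into weak formulas\<close>

lemma weak_formulas: "A \<in> weak \<Longrightarrow> A \<in> formulas"
proof (induction rule: weak.induct)
  case (1 X)
  then show ?case by (intro formulas.intros(1))
qed (auto intro: formulas.intros WDia_formulas And_formulas tau_ACT)

lemma act_F_weak: "A \<in> weak \<Longrightarrow> \<pi> \<in> perms \<Longrightarrow> act_F \<pi> A \<in> weak"
proof (induction rule: weak.induct)
  case (1 X)
  have X: "X \<subseteq> preforms" using "1.hyps" weak_formulas formulas_preforms by blast
  have "small (act_set act_F \<pi> X)" by (rule small_act_set[OF 1(4) X 1(2)])
  moreover have "B \<in> weak" if "B \<in> act_set act_F \<pi> X" for B
    using that "1.IH" 1(4) by (auto simp: act_set_def)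
  ultimately show ?case unfolding act_F_Conj[OF 1(4) X] by (intro weak.intros(1))
next
  case (2 A)
  then show ?case by (simp add: act_F_Neg weak.intros(2))
next
  case (3 \<alpha> A)
  then show ?case by (simp add: act_F_WDia weak_formulas weak.intros(3) nominal_closed[OF nominal_ACT])
next
  case (4 A \<phi>)
  have "act_F \<pi> (WDia (tau T) (And A (Pred \<phi>))) = WDia (tau T) (And (act_F \<pi> A) (Pred (act_P T \<pi> \<phi>)))"
    using 4 by (simp add: act_F_WDia act_F_And act_F_Pred weak_formulas And_formulas formulas.intros(3)
        tau_ACT act_tau)
  then show ?case using 4 by (simp add: weak.intros(4) nominal_closed[OF nominal_PRED])
qed

lemma And_weak: "A \<in> weak \<Longrightarrow> B \<in> weak \<Longrightarrow> And A B \<in> weak"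
  unfolding And_def by (intro weak.intros(1) small_finite) (auto intro: weak_formulas)

lemma Disj_weak: "X \<subseteq> weak \<Longrightarrow> small X \<Longrightarrow> Disj X \<in> weak"
  unfolding Disj_def by (intro weak.intros(1,2) small_Neg) (auto intro: weak.intros(2))

lemma WDia_tau_weak: "A \<in> weak \<Longrightarrow> WDia_tau A \<in> weak"
  using weak.intros(3)[OF tau_ACT] by (simp add: WDia_def)

text \<open>The stabiliser condition makes it possible to choose the translations of the members of
  a finitely supported family so that they form a finitely supported family again.\<close>

definition weakly_definable :: "('k, 'a, 'p) form \<Rightarrow> bool" where
  "weakly_definable E \<longleftrightarrow> E \<in> formulas \<and>
    (\<exists>A\<in>weak. equivalent E A \<and> (\<forall>\<pi>\<in>perms. act_F \<pi> E = E \<longrightarrow> act_F \<pi> A = A))"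

text \<open>The weak conjunct \<open>A\<close> absorbs the left conjuncts of a preformula, so that disjunctions are
  never nested and \<open>\<kappa>\<close> need not be regular.\<close>

definition weakly_predefinable :: "('k, 'a, 'p) form \<Rightarrow> bool" where
  "weakly_predefinable B \<longleftrightarrow> B \<in> formulas \<and>
    (\<forall>A\<in>weak. \<exists>C\<in>weak. equivalent (WDia_tau (And A B)) C \<and>
      (\<forall>\<pi>\<in>perms. act_F \<pi> A = A \<longrightarrow> act_F \<pi> B = B \<longrightarrow> act_F \<pi> C = C))"

lemma weakly_predefinableE:
  assumes "weakly_predefinable B" "A \<in> weak"
  obtains C where "C \<in> weak" "equivalent (WDia_tau (And A B)) C"
    "\<And>\<pi>. \<pi> \<in> perms \<Longrightarrow> act_F \<pi> A = A \<Longrightarrow> act_F \<pi> B = B \<Longrightarrow> act_F \<pi> C = C"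
proof -
  have "\<exists>C\<in>weak. equivalent (WDia_tau (And A B)) C \<and>
      (\<forall>\<pi>\<in>perms. act_F \<pi> A = A \<longrightarrow> act_F \<pi> B = B \<longrightarrow> act_F \<pi> C = C)"
    using assms by (simp add: weakly_predefinable_def)
  then show thesis using that by blast
qed

text \<open>Being a weak equivalent of a formula is an equivariant relation, and weak definability
  supplies exactly the witness fixed by stabilisers that \<open>equivariant_choice\<close>
  demands.\<close>

lemma weakly_definable_choice:
  obtains f where "\<And>E. weakly_definable E \<Longrightarrow> f E \<in> weak"
    "\<And>E. weakly_definable E \<Longrightarrow> equivalent E (f E)"
    "\<And>E \<pi>. weakly_definable E \<Longrightarrow> \<pi> \<in> perms \<Longrightarrow> f (act_F \<pi> E) = act_F \<pi> (f E)"
proof -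
  let ?R = "\<lambda>E A. E \<in> formulas \<and> A \<in> weak \<and> equivalent E A"
  have eqvt: "?R (act_F \<pi> E) (act_F \<pi> A)" if "\<pi> \<in> perms" "?R E A" for \<pi> E A
    using that act_F_formulas act_F_weak equivalent_act weak_formulas by auto
  have carrier: "E \<in> formulas \<and> A \<in> formulas" if "?R E A" for E A
    using that weak_formulas by blast
  obtain f where f: "\<And>E A. ?R E A \<Longrightarrow> \<forall>\<pi>\<in>perms. act_F \<pi> E = E \<longrightarrow> act_F \<pi> A = A \<Longrightarrow>
      ?R E (f E) \<and> (\<forall>\<pi>\<in>perms. f (act_F \<pi> E) = act_F \<pi> (f E))"
    using equivariant_choice[OF nominal_formulas nominal_formulas, of ?R, OF carrier eqvt] by blast
  have "f E \<in> weak \<and> equivalent E (f E) \<and> (\<forall>\<pi>\<in>perms. f (act_F \<pi> E) = act_F \<pi> (f E))"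
    if "weakly_definable E" for E
    using that f[of E] unfolding weakly_definable_def by blast
  then show thesis by (intro that[of f]) auto
qed

text \<open>The choice is made on pairs, because the translation depends on the weak conjunct as
  well. For fixed \<open>A\<close> the result is equivariant under the permutations that fix
  \<open>A\<close>.\<close>

lemma weakly_predefinable_choice:
  obtains g where "\<And>A B. weakly_predefinable B \<Longrightarrow> A \<in> weak \<Longrightarrow> g (A, B) \<in> weak"
    "\<And>A B. weakly_predefinable B \<Longrightarrow> A \<in> weak \<Longrightarrow> equivalent (WDia_tau (And A B)) (g (A, B))"
    "\<And>A B \<pi>. weakly_predefinable B \<Longrightarrow> A \<in> weak \<Longrightarrow> \<pi> \<in> perms \<Longrightarrow>
      g (act_F \<pi> A, act_F \<pi> B) = act_F \<pi> (g (A, B))"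
proof -
  let ?R = "\<lambda>(A, B) C. A \<in> weak \<and> B \<in> formulas \<and> C \<in> weak \<and> equivalent (WDia_tau (And A B)) C"
  have eqvt: "?R (act_pair act_F act_F \<pi> x) (act_F \<pi> C)" if "\<pi> \<in> perms" "?R x C" for \<pi> x C
  proof -
    obtain A B where x: "x = (A, B)" by (cases x)
    have "equivalent (act_F \<pi> (WDia_tau (And A B))) (act_F \<pi> C)"
      using that x by (intro equivalent_act) (auto intro: WDia_tau_formulas And_formulas weak_formulas)
    then show ?thesis
      using that x by (simp add: act_F_WDia_tau act_F_And And_formulas weak_formulas act_F_weak act_F_formulas)
  qed
  have carrier: "x \<in> formulas \<times> formulas \<and> C \<in> formulas" if "?R x C" for x C
    using that weak_formulas by auto
  obtain g where g: "\<And>x C. ?R x C \<Longrightarrow>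
      \<forall>\<pi>\<in>perms. act_pair act_F act_F \<pi> x = x \<longrightarrow> act_F \<pi> C = C \<Longrightarrow>
      ?R x (g x) \<and> (\<forall>\<pi>\<in>perms. g (act_pair act_F act_F \<pi> x) = act_F \<pi> (g x))"
    using equivariant_choice[OF nominal_set_pair[OF nominal_formulas nominal_formulas] nominal_formulas,
        of ?R, OF carrier eqvt] by blast
  have "g (A, B) \<in> weak \<and> equivalent (WDia_tau (And A B)) (g (A, B)) \<and>
      (\<forall>\<pi>\<in>perms. g (act_F \<pi> A, act_F \<pi> B) = act_F \<pi> (g (A, B)))"
    if h: "weakly_predefinable B" "A \<in> weak" for A B
  proof -
    obtain C where "C \<in> weak" "equivalent (WDia_tau (And A B)) C"
        "\<And>\<pi>. \<pi> \<in> perms \<Longrightarrow> act_F \<pi> A = A \<Longrightarrow> act_F \<pi> B = B \<Longrightarrow> act_F \<pi> C = C"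
      using weakly_predefinableE[OF h] by blast
    then show ?thesis using g[of "(A, B)" C] h by (simp add: weakly_predefinable_def)
  qed
  then show thesis by (intro that[of g]) auto
qed

text \<open>Equivariance of the choice function carries the stabiliser condition along the orbit. In
  \<open>weakly_predefinable_And\<close> this rules out an exchange of a definable and a
  non-definable conjunct.\<close>

lemma weakly_definable_act:
  assumes "weakly_definable E" "\<pi> \<in> perms"
  shows "weakly_definable (act_F \<pi> E)"
proof -
  obtain f where f: "f E \<in> weak" "equivalent E (f E)"
      "\<And>\<pi>. \<pi> \<in> perms \<Longrightarrow> f (act_F \<pi> E) = act_F \<pi> (f E)"
    using weakly_definable_choice assms(1) by metis
  have E: "E \<in> formulas" using assms(1) by (simp add: weakly_definable_def)
  have "act_F \<rho> (act_F \<pi> (f E)) = act_F \<pi> (f E)"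
    if "\<rho> \<in> perms" "act_F \<rho> (act_F \<pi> E) = act_F \<pi> E" for \<rho>
    using f(3)[of "\<rho> * \<pi>"] f(3)[of \<pi>] that assms(2) E weak_formulas[OF f(1)]
    by (simp add: nominal_mult[OF nominal_formulas])
  then show ?thesis
    unfolding weakly_definable_def
    using E f assms(2) act_F_formulas act_F_weak equivalent_act weak_formulas by blast
qed

text \<open>A permutation fixing \<open>Conj X\<close> need only permute the members of
  \<open>X\<close>. Equivariance of \<open>f\<close> lets it permute their translations in the same
  way, so the set of translations is fixed.\<close>

lemma weakly_definable_Conj:
  assumes X: "\<And>E. E \<in> X \<Longrightarrow> weakly_definable E" and small: "small X"
  shows "weakly_definable (Conj X)"
proof -
  obtain f where f: "\<And>E. weakly_definable E \<Longrightarrow> f E \<in> weak"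
    "\<And>E. weakly_definable E \<Longrightarrow> equivalent E (f E)"
    "\<And>E \<pi>. weakly_definable E \<Longrightarrow> \<pi> \<in> perms \<Longrightarrow> f (act_F \<pi> E) = act_F \<pi> (f E)"
    using weakly_definable_choice by blast
  have Xf: "X \<subseteq> formulas" using X by (auto simp: weakly_definable_def)
  have C: "Conj X \<in> formulas" by (rule Conj_formulas[OF Xf small])
  have fX: "f ` X \<subseteq> weak" "f ` X \<subseteq> formulas" using X f(1) weak_formulas by auto
  have sm: "small (f ` X)" by (rule small_image[OF small, of "{}"]) (use X f(3) in auto)
  have W: "Conj (f ` X) \<in> weak" using fX(1) sm by (intro weak.intros(1)) auto
  have "equivalent (Conj X) (Conj (f ` X))"
    using f(2) X unfolding equivalent_def
    by (simp add: sat_Conj[OF C Xf] sat_Conj[OF weak_formulas[OF W] fX(2)])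
  moreover have "act_F \<pi> (Conj (f ` X)) = Conj (f ` X)"
    if \<pi>: "\<pi> \<in> perms" and eq: "act_F \<pi> (Conj X) = Conj X" for \<pi>
  proof -
    have "Conj X = Conj (act_set act_F \<pi> X)"
      using eq act_F_Conj[OF \<pi>] Xf formulas_preforms by (metis subset_iff)
    then have inv: "act_F \<pi> ` X = X"
      using Conj_eq_iff[OF C Xf act_set_closed[OF nominal_formulas \<pi> Xf]] by (simp add: act_set_def)
    have "act_set act_F \<pi> (f ` X) = f ` act_F \<pi> ` X"
      unfolding act_set_def image_image by (rule image_cong) (simp_all add: X f(3) \<pi>)
    then have "act_set act_F \<pi> (f ` X) = f ` X" by (simp only: inv)
    then show ?thesis using act_F_Conj[OF \<pi>, of "f ` X"] fX(2) formulas_preforms by (metis subset_iff)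
  qed
  ultimately show ?thesis unfolding weakly_definable_def using C W by blast
qed

lemma weakly_definable_Neg:
  assumes "weakly_definable E"
  shows "weakly_definable (Neg E)"
proof -
  obtain A where A: "E \<in> formulas" "A \<in> weak" "equivalent E A"
      "\<forall>\<pi>\<in>perms. act_F \<pi> E = E \<longrightarrow> act_F \<pi> A = A"
    using assms unfolding weakly_definable_def by blast
  have "equivalent (Neg E) (Neg A)"
    using A(3) unfolding equivalent_def by (simp add: sat_Neg A(1) weak_formulas[OF A(2)])
  then show ?thesis
    unfolding weakly_definable_def using A formulas.intros(2) weak.intros(2)
    by (intro conjI bexI[of _ "Neg A"]) (auto simp: act_F_Neg Neg_eq_iff)
qed

text \<open>A permutation fixing the diamond agrees on label and body with an admissible renaming
  \<open>\<rho>\<close> of bound names. It must fix the translated diamond too, which requires that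
  \<open>\<rho>\<close> be admissible there: hence the comparison of supports. \<open>?E\<close> and
  \<open>?A\<close> are the bodies of \<open>Dia\<close> when \<open>\<alpha>\<close> is not
  silent.\<close>

lemma weakly_definable_WDia:
  assumes "weakly_definable E" and \<alpha>: "\<alpha> \<in> ACT T"
  shows "weakly_definable (WDia \<alpha> E)"
proof -
  obtain A where E: "E \<in> formulas" and A: "A \<in> weak" "equivalent E A"
      and stab: "\<And>\<pi>. \<pi> \<in> perms \<Longrightarrow> act_F \<pi> E = E \<Longrightarrow> act_F \<pi> A = A"
    using assms unfolding weakly_definable_def by blast
  have Af: "A \<in> formulas" by (rule weak_formulas[OF A(1)])
  let ?E = "WDia_tau E" and ?A = "WDia_tau A"
  have EA: "?E \<in> formulas" "?A \<in> formulas" using E Af by (simp_all add: WDia_tau_formulas)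
  have stab': "act_F \<pi> ?A = ?A" if "\<pi> \<in> perms" "act_F \<pi> ?E = ?E" for \<pi>
  proof -
    have "act_F \<pi> E = E"
      by (rule WDia_tau_eqD) (use that E in \<open>simp_all add: act_F_WDia_tau act_F_formulas\<close>)
    then show ?thesis using that(1) Af stab by (simp add: act_F_WDia_tau)
  qed
  \<comment> \<open>The stabiliser condition bounds the support: permutations fixing the support of
    \<open>?E\<close> pointwise fix \<open>?E\<close>, hence \<open>?A\<close>.\<close>
  have "supports act_F (supp act_F ?E) ?A"
    unfolding supports_def using stab' act_supp_fixed[OF nominal_formulas EA(1)] by blast
  then have supp: "supp act_F ?A \<subseteq> supp act_F ?E"
    using supp_supports(1)[OF nominal_formulas EA(1)] by (intro supp_subset[OF nominal_formulas])
  have "act_F \<pi> (WDia \<alpha> A) = WDia \<alpha> A"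
      if \<pi>: "\<pi> \<in> perms" and eq: "act_F \<pi> (WDia \<alpha> E) = WDia \<alpha> E" for \<pi>
  proof (cases "\<alpha> = tau T")
    case True
    then show ?thesis using stab'[OF \<pi>] eq by (simp add: WDia_def)
  next
    case False
    have c: "act_A T \<pi> \<alpha> \<in> ACT T" "act_F \<pi> ?E \<in> formulas"
      using \<alpha> \<pi> EA nominal_closed[OF nominal_ACT] act_F_formulas by auto
    have "WDia_tau (Dia (act_A T \<pi> \<alpha>) (act_F \<pi> ?E)) = WDia_tau (Dia \<alpha> ?E)"
      using eq False \<pi> \<alpha> EA(1)
      by (simp add: WDia_def act_F_WDia_tau act_F_Dia formulas_preforms formulas.intros(4))
    then have "Dia (act_A T \<pi> \<alpha>) (act_F \<pi> ?E) = Dia \<alpha> ?E"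
      by (rule WDia_tau_eqD) (use c \<alpha> EA(1) in \<open>simp_all add: formulas.intros(4)\<close>)
    then obtain \<rho> where \<rho>: "\<rho> \<in> perms" "fixes_names \<rho> (supp act_AF (\<alpha>, ?E) - bn T \<alpha>)"
        "act_A T \<pi> \<alpha> = act_A T \<rho> \<alpha>" "act_F \<pi> ?E = act_F \<rho> ?E"
      using Dia_eqD[OF _ c(1) EA(1) c(2)] by metis
    \<comment> \<open>\<open>inverse \<rho> * \<pi>\<close> stabilises \<open>?E\<close> and
      therefore \<open>?A\<close>, so \<open>\<pi>\<close> and \<open>\<rho>\<close> agree on
      \<open>?A\<close> as well.\<close>
    have p: "inverse \<rho> * \<pi> \<in> perms" using \<rho>(1) \<pi> by simp
    have "act_F (inverse \<rho> * \<pi>) ?E = ?E"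
      using \<rho>(1,4) \<pi> EA(1) by (simp add: nominal_mult[OF nominal_formulas] nominal_inverse[OF nominal_formulas])
    then have "act_F (inverse \<rho> * \<pi>) ?A = ?A" by (rule stab'[OF p])
    then have "act_F (inverse \<rho>) (act_F \<pi> ?A) = ?A"
      using \<rho>(1) \<pi> EA(2) by (simp add: nominal_mult[OF nominal_formulas])
    then have e: "act_F \<pi> ?A = act_F \<rho> ?A"
      using nominal_inverse(2)[OF nominal_formulas \<rho>(1) act_F_formulas[OF EA(2) \<pi>]] by simp
    have "supp act_AF (\<alpha>, ?A) \<subseteq> supp act_AF (\<alpha>, ?E)"
      using supp supp_pair[OF nominal_ACT nominal_formulas \<alpha>] EA by auto
    then have "fixes_names \<rho> (supp act_AF (\<alpha>, ?A) - bn T \<alpha>)"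
      using \<rho>(2) unfolding fixes_names_def by blast
    then have "Dia (act_A T \<pi> \<alpha>) (act_F \<pi> ?A) = Dia \<alpha> ?A"
      unfolding \<rho>(3) e by (rule Dia_alpha[OF \<alpha> formulas_preforms[OF EA(2)] \<rho>(1)])
    then show ?thesis
      using False \<pi> \<alpha> EA(2)
      by (simp add: WDia_def act_F_WDia_tau act_F_Dia formulas_preforms formulas.intros(4))
  qed
  then show ?thesis
    unfolding weakly_definable_def
    using WDia_formulas[OF \<alpha> E] weak.intros(3)[OF \<alpha> A(1)] equivalent_WDia[OF A(2) \<alpha> E Af] by blast
qed

text \<open>The weak conjunct is taken to be the empty conjunction, which is true everywhere and
  fixed by all permutations.\<close>

lemma weakly_definable_WDia_tau:
  assumes "weakly_predefinable B"
  shows "weakly_definable (WDia_tau B)"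
proof -
  have B: "B \<in> formulas" using assms by (simp add: weakly_predefinable_def)
  have T: "Conj {} \<in> weak" by (intro weak.intros(1) small_finite) auto
  have Tf: "Conj {} \<in> formulas" by (rule weak_formulas[OF T])
  obtain C where C: "C \<in> weak" "equivalent (WDia_tau (And (Conj {}) B)) C"
      and stab: "\<And>\<pi>. \<pi> \<in> perms \<Longrightarrow> act_F \<pi> (Conj {}) = Conj {} \<Longrightarrow> act_F \<pi> B = B \<Longrightarrow> act_F \<pi> C = C"
    using weakly_predefinableE[OF assms T] by blast
  have "equivalent B (And (Conj {}) B)"
    using B Tf by (simp add: equivalent_def sat_And sat_Conj)
  then have "equivalent (WDia_tau B) (WDia_tau (And (Conj {}) B))"
    using B Tf by (intro equivalent_WDia_tau And_formulas)
  then have "equivalent (WDia_tau B) C" using C(2) by (simp add: equivalent_def)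
  moreover have "act_F \<pi> C = C" if "\<pi> \<in> perms" "act_F \<pi> (WDia_tau B) = WDia_tau B" for \<pi>
  proof (rule stab[OF that(1)])
    show "act_F \<pi> (Conj {}) = Conj {}" using that by (simp add: act_F_Conj act_set_def)
    show "act_F \<pi> B = B"
      by (rule WDia_tau_eqD) (use that B in \<open>simp_all add: act_F_WDia_tau act_F_formulas\<close>)
  qed
  ultimately show ?thesis
    unfolding weakly_definable_def using C(1) WDia_tau_formulas[OF B] by blast
qed

text \<open>A permutation fixing \<open>E \<and> B\<close> may exchange the two conjuncts. In that case \<open>B\<close> has a
  translation of its own, and the conjuncts can be treated symmetrically.\<close>

lemma weakly_predefinable_And:
  assumes E: "weakly_definable E" and B: "weakly_predefinable B"
  shows "weakly_predefinable (And E B)"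
proof -
  obtain f where f: "\<And>E. weakly_definable E \<Longrightarrow> f E \<in> weak"
    "\<And>E. weakly_definable E \<Longrightarrow> equivalent E (f E)"
    "\<And>E \<pi>. weakly_definable E \<Longrightarrow> \<pi> \<in> perms \<Longrightarrow> f (act_F \<pi> E) = act_F \<pi> (f E)"
    using weakly_definable_choice by blast
  have Ef: "E \<in> formulas" and Bf: "B \<in> formulas"
    using E B by (auto simp: weakly_definable_def weakly_predefinable_def)
  have EB: "And E B \<in> formulas" by (rule And_formulas[OF Ef Bf])
  have fE: "f E \<in> formulas" using f(1)[OF E] by (rule weak_formulas)
  have pair: "{act_F \<pi> E, act_F \<pi> B} = {E, B}" if "\<pi> \<in> perms" "act_F \<pi> (And E B) = And E B" for \<pi>
    by (rule And_eqD) (use that Ef Bf in \<open>simp_all add: act_F_And act_F_formulas\<close>)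
  have "\<exists>C\<in>weak. equivalent (WDia_tau (And A (And E B))) C \<and>
      (\<forall>\<pi>\<in>perms. act_F \<pi> A = A \<longrightarrow> act_F \<pi> (And E B) = And E B \<longrightarrow> act_F \<pi> C = C)"
    if A: "A \<in> weak" for A
  proof (cases "weakly_definable B")
    case True
    have Af: "A \<in> formulas" by (rule weak_formulas[OF A])
    have fB: "f B \<in> formulas" using f(1)[OF True] by (rule weak_formulas)
    let ?C = "WDia_tau (And A (And (f E) (f B)))"
    have "equivalent (And A (And E B)) (And A (And (f E) (f B)))"
      using f(2)[OF E] f(2)[OF True] Af Ef Bf fE fB
      by (simp add: equivalent_def sat_And And_formulas)
    then have "equivalent (WDia_tau (And A (And E B))) ?C"
      using Af Ef Bf fE fB by (intro equivalent_WDia_tau And_formulas)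
    moreover have "?C \<in> weak" using A f(1)[OF E] f(1)[OF True] by (intro WDia_tau_weak And_weak)
    moreover have "act_F \<pi> ?C = ?C"
      if h: "\<pi> \<in> perms" "act_F \<pi> A = A" "act_F \<pi> (And E B) = And E B" for \<pi>
    proof -
      have "{f (act_F \<pi> E), f (act_F \<pi> B)} = {f E, f B}"
        using arg_cong[OF pair[OF h(1,3)], of "image f"] by simp
      then have "And (act_F \<pi> (f E)) (act_F \<pi> (f B)) = And (f E) (f B)"
        using f(3)[OF E h(1)] f(3)[OF True h(1)] by (simp add: And_def)
      then show ?thesis using h Af fE fB by (simp add: act_F_WDia_tau act_F_And And_formulas)
    qed
    ultimately show ?thesis by blast
  next
    case False
    have Af: "A \<in> formulas" by (rule weak_formulas[OF A])
    let ?A = "And A (f E)"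
    have A': "?A \<in> weak" "?A \<in> formulas" using A f(1)[OF E] Af fE by (simp_all add: And_weak And_formulas)
    obtain C where C: "C \<in> weak" "equivalent (WDia_tau (And ?A B)) C"
        and stab: "\<And>\<pi>. \<pi> \<in> perms \<Longrightarrow> act_F \<pi> ?A = ?A \<Longrightarrow> act_F \<pi> B = B \<Longrightarrow> act_F \<pi> C = C"
      using weakly_predefinableE[OF B A'(1)] by blast
    have "equivalent (And A (And E B)) (And ?A B)"
      using f(2)[OF E] Af Ef Bf fE by (auto simp: equivalent_def sat_And And_formulas)
    then have "equivalent (WDia_tau (And A (And E B))) (WDia_tau (And ?A B))"
      using Af Ef Bf fE by (intro equivalent_WDia_tau And_formulas)
    then have "equivalent (WDia_tau (And A (And E B))) C" using C(2) by (simp add: equivalent_def)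
    moreover have "act_F \<pi> C = C"
      if h: "\<pi> \<in> perms" "act_F \<pi> A = A" "act_F \<pi> (And E B) = And E B" for \<pi>
    proof -
      \<comment> \<open>An exchange would make \<open>B\<close> a permuted copy of the definable
        \<open>E\<close>, hence definable, against the case assumption. So each conjunct is fixed
        separately.\<close>
      have "act_F \<pi> E \<noteq> B" using False weakly_definable_act[OF E h(1)] by auto
      moreover have "E \<noteq> B" using False E by auto
      ultimately have e: "act_F \<pi> E = E" "act_F \<pi> B = B"
        using pair[OF h(1,3)] by (auto simp: doubleton_eq_iff)
      have "act_F \<pi> ?A = ?A" using f(3)[OF E h(1)] e(1) h Af fE by (simp add: act_F_And)
      then show ?thesis using e(2) h(1) stab by blast
    qed
    ultimately show ?thesis using C(1) by blast
  qed
  then show ?thesis unfolding weakly_predefinable_def using EB by blast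
qed

text \<open>The formula to be translated is already weak, by the rule that admits one predicate next
  to a weak formula. This is where the absorbed conjuncts end up.\<close>

lemma weakly_predefinable_Pred:
  assumes "\<phi> \<in> PRED T"
  shows "weakly_predefinable (Pred \<phi>)"
proof -
  have f: "Pred \<phi> \<in> formulas" by (rule formulas.intros(3)[OF assms])
  have "WDia_tau (And A (Pred \<phi>)) \<in> weak" if "A \<in> weak" for A
    using weak.intros(4)[OF that assms] by (simp add: WDia_def)
  moreover have "act_F \<pi> (WDia_tau (And A (Pred \<phi>))) = WDia_tau (And A (Pred \<phi>))"
    if "A \<in> weak" "\<pi> \<in> perms" "act_F \<pi> A = A" "act_F \<pi> (Pred \<phi>) = Pred \<phi>" for A \<pi>
    using that f by (simp add: act_F_WDia_tau act_F_And And_formulas weak_formulas)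
  ultimately show ?thesis unfolding weakly_predefinable_def using f
    by (intro conjI ballI) (auto simp: equivalent_def)
qed

text \<open>All disjuncts share the conjunct \<open>A\<close>, so the translations depend on its
  names; its finite support enters through \<open>small_image\<close>. A permutation fixing
  \<open>A\<close> and the disjunction permutes \<open>X\<close>, and the translations with
  it.\<close>

lemma weakly_predefinable_Disj:
  assumes X: "\<And>B. B \<in> X \<Longrightarrow> weakly_predefinable B" and small: "small X"
  shows "weakly_predefinable (Disj X)"
proof -
  obtain g where g: "\<And>A B. weakly_predefinable B \<Longrightarrow> A \<in> weak \<Longrightarrow> g (A, B) \<in> weak"
    "\<And>A B. weakly_predefinable B \<Longrightarrow> A \<in> weak \<Longrightarrow> equivalent (WDia_tau (And A B)) (g (A, B))"
    "\<And>A B \<pi>. weakly_predefinable B \<Longrightarrow> A \<in> weak \<Longrightarrow> \<pi> \<in> perms \<Longrightarrow>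
      g (act_F \<pi> A, act_F \<pi> B) = act_F \<pi> (g (A, B))"
    using weakly_predefinable_choice by blast
  have Xf: "X \<subseteq> formulas" using X by (auto simp: weakly_predefinable_def)
  have D: "Disj X \<in> formulas" by (rule Disj_formulas[OF Xf small])
  have "\<exists>C\<in>weak. equivalent (WDia_tau (And A (Disj X))) C \<and>
      (\<forall>\<pi>\<in>perms. act_F \<pi> A = A \<longrightarrow> act_F \<pi> (Disj X) = Disj X \<longrightarrow> act_F \<pi> C = C)"
    if A: "A \<in> weak" for A
  proof -
    have Af: "A \<in> formulas" by (rule weak_formulas[OF A])
    let ?Y = "(\<lambda>B. g (A, B)) ` X"
    have Y: "?Y \<subseteq> weak" "?Y \<subseteq> formulas" using X g(1) A weak_formulas by auto
    have sm: "small ?Y"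
    proof (rule small_image[OF small])
      show "finite (supp act_F A)" by (rule supp_supports(1)[OF nominal_formulas Af])
      show "g (A, act_F \<pi> B) = act_F \<pi> (g (A, B))"
        if "\<pi> \<in> perms" "fixes_names \<pi> (supp act_F A)" "B \<in> X" for \<pi> B
        using g(3)[OF X[OF that(3)] A that(1)] act_supp_fixed[OF nominal_formulas Af that(1,2)] by simp
    qed
    have "P \<Turnstile> WDia_tau (And A (Disj X)) \<longleftrightarrow> P \<Turnstile> Disj ?Y" if P: "P \<in> STATES T" for P
    proof -
      have "P \<Turnstile> WDia_tau (And A (Disj X)) \<longleftrightarrow> (\<exists>B\<in>X. P \<Turnstile> WDia_tau (And A B))"
        using Xf P Af D by (auto simp: sat_WDia_tau And_formulas sat_And sat_Disj[OF Xf small] subset_iff)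
      also have "\<dots> \<longleftrightarrow> (\<exists>B\<in>X. P \<Turnstile> g (A, B))"
          using g(2) X A P by (simp add: equivalent_def)
      finally show ?thesis using sat_Disj[OF Y(2) sm] by simp
    qed
    then have "equivalent (WDia_tau (And A (Disj X))) (Disj ?Y)" by (simp add: equivalent_def)
    moreover have "act_F \<pi> (Disj ?Y) = Disj ?Y"
      if h: "\<pi> \<in> perms" "act_F \<pi> A = A" "act_F \<pi> (Disj X) = Disj X" for \<pi>
    proof -
      have inv: "act_F \<pi> ` X = X"
        using h(3) Disj_eq_iff[OF Xf small act_set_closed[OF nominal_formulas h(1) Xf]]
          act_F_Disj[OF Xf h(1)] by (simp add: act_set_def)
      have "act_set act_F \<pi> ?Y = (\<lambda>B. g (A, B)) ` act_F \<pi> ` X"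
        unfolding act_set_def image_image
      proof (rule image_cong[OF refl])
        fix B assume "B \<in> X"
        then show "act_F \<pi> (g (A, B)) = g (A, act_F \<pi> B)" using g(3)[OF X A h(1), of B] h(2) by simp
      qed
      then have "act_set act_F \<pi> ?Y = ?Y" by (simp only: inv)
      then show ?thesis using act_F_Disj[OF Y(2) h(1)] by simp
    qed
    ultimately show ?thesis using Disj_weak[OF Y(1) sm] by blast
  qed
  then show ?thesis unfolding weakly_predefinable_def using D by blast
qed

lemma ext_weak_weakly_definable: "E \<in> ext_weak \<Longrightarrow> weakly_definable E"
  and preformulas_weakly_predefinable: "B \<in> preformulas \<Longrightarrow> weakly_predefinable B"
proof (induction rule: ext_weak_preformulas.inducts)
  case (4 B)
  then show ?case using weakly_definable_WDia_tau by (simp add: WDia_def)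
qed (auto intro: weakly_definable_Conj weakly_definable_Neg weakly_definable_WDia
    weakly_predefinable_And weakly_predefinable_Pred weakly_predefinable_Disj)

end

theorem theorem7p25:
  fixes T :: "('n, 'srt, 's, 'p, 'a) nts" and \<kappa> :: "'k rel"
    and E :: "('k, 'a, 'p) form"
  assumes "nts_logic T \<kappa>"
    and "E \<in> nts_logic.ext_weak T \<kappa>"
  shows "\<exists>A \<in> nts_logic.weak T \<kappa>. \<forall>P \<in> STATES T.
           nts_logic.sat T \<kappa> P E \<longleftrightarrow> nts_logic.sat T \<kappa> P A"
proof -
  interpret nts_logic T \<kappa> by (rule assms(1))
  show ?thesis
    using ext_weak_weakly_definable[OF assms(2)] unfolding weakly_definable_def equivalent_def by blast
qed

end
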